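(* For any fixed constant $\gamma>0$ there is $d_0=d_0(\gamma)$ such that for all $d\ge d_0$ the following holds. Given query access to gradient or function value of a function $f:\mathbb{R}^d\to\mathbb{R}$ that is $1.5$-smooth and $0.5$-strongly convex, any algorithm that makes $o\left(d^{1-\gamma}\varepsilon^{-(2-\gamma)}\right)$ queries cannot estimate the normalizing constant $Z=\int_{\mathbb{R}^d}e^{-f(x)}\,dx$ within a multiplicative factor of $1\pm\varepsilon$ with probability more than $3/4$.
   Context: $f$ is $\mu$-strongly convex and $L$-smooth if $\frac{\mu}{2}\|x-y\|^2\le f(y)-f(x)-\nabla f(x)^\top(y-x)\le\frac L2\|x-y\|^2$ for all $x,y\in\mathbb{R}^d$. An algorithm is an adaptive randomized procedure which, for given $d$ and $\varepsilon$, chooses query points one after another; each query at $x$ returns $f(x)$ and $\nabla f(x)$; after its queries it outputs a number $\widehat Z$. It estimates $Z$ within a factor $1\pm\varepsilon$ with probability more than $3/4$ if, for every $f$ in the class, $\Pr\left[(1-\varepsilon)Z\le\widehat Z\le(1+\varepsilon)Z\right]>3/4$ over its internal randomness. The $o(\cdot)$ is understood as $\varepsilon\to0$, uniformly in $d\ge d_0$, with $\gamma$ fixed: if $q(d,\varepsilon)$ denotes the maximal number of queries and $\sup_{d\ge d_0}q(d,\varepsilon)/\left(d^{1-\gamma}\varepsilon^{-(2-\gamma)}\right)\to0$ as $\varepsilon\to0$, then there is $\varepsilon_0>0$ such that for all $\varepsilon\le\varepsilon_0$ and all $d\ge d_0$ the algorithm does not achieve the estimation guarantee, i.e. it fails it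 for some $f$ in the class. *)

theory Defs
  imports "HOL-Probability.Probability"
begin

text \<open>The dimension is quantified inside the theorem, so \<open>\<real>\<^sup>d\<close> is the carrier \<open>euclid d\<close> of extensional
  functions on \<open>{..<d}\<close>; this is the space of the measure \<open>PiM {..<d} (\<lambda>_. lborel)\<close>, which
  is Lebesgue measure. The Euclidean norm of \<open>v\<close> is the library's \<open>L2_set v {..<d}\<close>.\<close>

type_synonym point = "nat \<Rightarrow> real"

definition euclid :: "nat \<Rightarrow> point set" where
  "euclid d = {..<d} \<rightarrow>\<^sub>E UNIV"

definition edist :: "nat \<Rightarrow> point \<Rightarrow> point \<Rightarrow> real" where
  "edist d x y = L2_set (\<lambda>i. x i - y i) {..<d}"

text \<open>Frechet differentiability on \<open>\<real>\<^sup>d\<close>, with the derivative represented by the vector \<open>g\<close>.\<close>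

definition has_gradient :: "nat \<Rightarrow> (point \<Rightarrow> real) \<Rightarrow> point \<Rightarrow> point \<Rightarrow> bool" where
  "has_gradient d f x g \<longleftrightarrow> g \<in> euclid d \<and>
     (\<forall>e>0. \<exists>\<delta>>0. \<forall>y\<in>euclid d. edist d y x < \<delta> \<longrightarrow>
        \<bar>f y - f x - (\<Sum>i<d. g i * (y i - x i))\<bar> \<le> e * edist d y x)"

definition gradient :: "nat \<Rightarrow> (point \<Rightarrow> real) \<Rightarrow> point \<Rightarrow> point" where
  "gradient d f x = (THE g. has_gradient d f x g)"

definition strongly_convex_smooth :: "real \<Rightarrow> real \<Rightarrow> nat \<Rightarrow> (point \<Rightarrow> real) set" where
  "strongly_convex_smooth \<mu> L d = {f.
     (\<forall>x\<in>euclid d. \<exists>g. has_gradient d f x g) \<and>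
     (\<forall>x\<in>euclid d. \<forall>y\<in>euclid d.
        \<mu> / 2 * (edist d x y)\<^sup>2 \<le> f y - f x - (\<Sum>i<d. gradient d f x i * (y i - x i)) \<and>
        f y - f x - (\<Sum>i<d. gradient d f x i * (y i - x i)) \<le> L / 2 * (edist d x y)\<^sup>2)}"

definition normalizing_constant :: "nat \<Rightarrow> (point \<Rightarrow> real) \<Rightarrow> real" where
  "normalizing_constant d f = (\<integral>x. exp (- f x) \<partial>(PiM {..<d} (\<lambda>_. lborel)))"

text \<open>A deterministic adaptive procedure maps the queries made so far, with their answers
  (function value and gradient), to the next query or to the final output.\<close>

datatype action = Query point | Output real

type_synonym strategy = "(point \<times> real \<times> point) list \<Rightarrow> action"

fun history :: "nat \<Rightarrow> strategy \<Rightarrow> (point \<Rightarrow> real) \<Rightarrow> nat \<Rightarrow> (point \<times> real \<times> point) list" where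
  "history d A f 0 = []"
| "history d A f (Suc n) =
     (case A (history d A f n) of
        Query x \<Rightarrow> history d A f n @ [(x, f x, gradient d f x)]
      | Output z \<Rightarrow> history d A f n)"

definition outputs :: "nat \<Rightarrow> strategy \<Rightarrow> (point \<Rightarrow> real) \<Rightarrow> real \<Rightarrow> bool" where
  "outputs d A f z \<longleftrightarrow> (\<exists>n. A (history d A f n) = Output z)"

text \<open>\<open>\<infinity>\<close>, the infimum of the empty set, if the procedure never outputs anything.\<close>

definition num_queries :: "nat \<Rightarrow> strategy \<Rightarrow> (point \<Rightarrow> real) \<Rightarrow> enat" where
  "num_queries d A f = Inf {enat n | n. \<exists>z. A (history d A f n) = Output z}"

text \<open>A randomized procedure is a probability measure on strategies, with an arbitrary
  \<open>\<sigma>\<close>-algebra. This covers internal randomness in any probability space \<open>\<Omega>\<close>: push it forward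
  along the map from seeds to strategies, taking the image as the space and the sets with
  measurable preimage as the \<open>\<sigma>\<close>-algebra. Unlike a type variable for the seeds, it keeps the
  threshold \<open>d\<^sub>0\<close> of the theorem independent of the type of the randomness.\<close>

definition randomized_algorithm :: "nat \<Rightarrow> strategy measure \<Rightarrow> bool" where
  "randomized_algorithm d P \<longleftrightarrow> prob_space P \<and>
     (\<forall>A\<in>space P. \<forall>h x. A h = Query x \<longrightarrow> x \<in> euclid d)"

definition max_queries :: "(point \<Rightarrow> real) set \<Rightarrow> nat \<Rightarrow> strategy measure \<Rightarrow> enat" where
  "max_queries F d P = (SUP A\<in>space P. SUP f\<in>F. num_queries d A f)"

text \<open>If the success event is not measurable, its \<open>measure\<close> is \<open>0\<close> and the guarantee does not hold.\<close>

definition estimates_Z :: "(point \<Rightarrow> real) set \<Rightarrow> nat \<Rightarrow> real \<Rightarrow> strategy measure \<Rightarrow> bool" where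
  "estimates_Z F d \<epsilon> P \<longleftrightarrow> (\<forall>f\<in>F.
     measure P {A \<in> space P. \<exists>z. outputs d A f z \<and>
       (1 - \<epsilon>) * normalizing_constant d f \<le> z \<and>
       z \<le> (1 + \<epsilon>) * normalizing_constant d f} > 3 / 4)"

end

theory Submission
  imports Defs
begin

text \<open>Fix a block length \<open>k \<ge> 8 / \<gamma>\<close>, split the coordinates into \<open>m = d div k\<close> blocks, and in each block
  divide the unit cube into \<open>p\<^sup>k\<close> cells. For every set \<open>b\<close> of cells (of all blocks) add to \<open>\<parallel>x\<parallel>\<^sup>2 / 2\<close>
  one small bump per cell of \<open>b\<close>. A query sees at most one cell of each block, that is, at most \<open>m\<close> bits of \<open>b\<close>,
  so \<open>n \<le> p\<^sup>k / 2\<close> queries leave at least half of the bits free. Each free bit moves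
  \<open>- ln Z\<close> monotonically by at least a constant times \<open>p\<^bsup>-(k+2)\<^esup>\<close>, hence by a Littlewood--Offord type
  argument \<open>- ln Z\<close> avoids every fixed interval of length of order \<open>\<epsilon>\<close> for a quarter of the choices, as long as
  \<open>\<epsilon>\<^sup>2 p\<^bsup>k+4\<^esup>\<close> is at most a small multiple of \<open>m\<close>. Choosing \<open>p\<close> maximal, \<open>p\<^sup>k\<close> is of order
  \<open>(d / \<epsilon>\<^sup>2)\<^bsup>k/(k+4)\<^esup>\<close>, which dominates \<open>d\<^bsup>1-\<gamma>\<^esup> \<epsilon>\<^bsup>-(2-\<gamma>)\<^esup>\<close>. A randomized algorithm is averaged
  against the uniform distribution of \<open>b\<close>.\<close>

subsection \<open>Anticoncentration of monotone set functions\<close>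

text \<open>Averaging over the deletion of one element of \<open>A\<close> reduces the sum over the proper subsets to
  the induction hypothesis; if \<open>A\<close> itself lies in the range, the range for the smaller sets shrinks by \<open>s\<close>,
  which pays for the term of \<open>A\<close>.\<close>

lemma LYM_interval:
  fixes F :: "'a set \<Rightarrow> real"
  assumes "finite A" "s > 0" "u \<le> v + s"
    and step: "\<And>S e. S \<subseteq> A \<Longrightarrow> e \<in> A - S \<Longrightarrow> F S + s \<le> F (insert e S)"
  shows "(\<Sum>S | S \<subseteq> A \<and> u \<le> F S \<and> F S \<le> v. 1 / real (card A choose card S)) \<le> (v - u) / s + 1"
  using assms(1,3) step
proof (induction "card A" arbitrary: A v)
  case 0
  then have [simp]: "A = {}" by simp
  have "(\<Sum>S | S \<subseteq> A \<and> u \<le> F S \<and> F S \<le> v. 1 / real (card A choose card S)) = (if u \<le> F {} \<and> F {} \<le> v then 1 else 0)"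
  proof -
    have "{S. S \<subseteq> A \<and> u \<le> F S \<and> F S \<le> v} = (if u \<le> F {} \<and> F {} \<le> v then {{}} else {})" by auto
    then show ?thesis by simp
  qed
  also have "\<dots> \<le> (v - u) / s + 1" using \<open>s > 0\<close> 0 by (auto simp: field_simps)
  finally show ?case .
next
  case (Suc n)
  note fin = \<open>finite A\<close>
  let ?B = "\<lambda>A v. {S. S \<subseteq> A \<and> u \<le> F S \<and> F S \<le> v}"
  let ?w = "\<lambda>A S. 1 / real (card A choose card S)"
  have finB: "finite (?B A v)" for v using fin by simp
  \<comment> \<open>Each proper subset \<open>S\<close> is counted once for every \<open>i\<close>
    outside it, and \<open>(n + 1 - card S) * (n + 1 choose card S) = (n + 1) * (n choose card
    S)\<close> turns its weight in \<open>A - {i}\<close> into its weight in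
    \<open>A\<close>.\<close>
  have avg: "(\<Sum>S\<in>?B A v - {A}. ?w A S) = (\<Sum>i\<in>A. \<Sum>S\<in>?B (A - {i}) v. ?w (A - {i}) S) / real (Suc n)"
  proof -
    have "(\<Sum>i\<in>A. \<Sum>S\<in>?B (A - {i}) v. ?w (A - {i}) S)
        = (\<Sum>i\<in>A. \<Sum>S\<in>?B A v - {A}. if i \<in> S then 0 else 1 / real (n choose card S))"
    proof (rule sum.cong[OF refl])
      fix i assume i: "i \<in> A"
      have cardi: "card (A - {i}) = n" using i fin Suc.hyps(2) by simp
      have "(\<Sum>S\<in>?B A v - {A}. if i \<in> S then 0 else 1 / real (n choose card S))
          = (\<Sum>S\<in>?B (A - {i}) v. if i \<in> S then 0 else 1 / real (n choose card S))" (is "?l = _")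
        using i fin by (intro sum.mono_neutral_right) (auto split: if_splits)
      also have "\<dots> = (\<Sum>S\<in>?B (A - {i}) v. ?w (A - {i}) S)"
        using cardi by (intro sum.cong) auto
      finally show "(\<Sum>S\<in>?B (A - {i}) v. ?w (A - {i}) S)
          = ?l" by (rule sym)
    qed
    also have "\<dots> = (\<Sum>S\<in>?B A v - {A}. \<Sum>i\<in>A. if i \<in> S then 0 else 1 / real (n choose card S))"
      by (rule sum.swap)
    also have "\<dots> = (\<Sum>S\<in>?B A v - {A}. real (Suc n) * ?w A S)"
    proof (intro sum.cong refl)
      fix S assume S: "S \<in> ?B A v - {A}"
      then have "S \<subset> A" by auto
      then have c: "card S \<le> n" using psubset_card_mono[OF fin, of S] Suc.hyps(2) by linarith
      have "(\<Sum>i\<in>A. if i \<in> S then 0 else 1 / real (n choose card S)) = (\<Sum>i\<in>A - S. 1 / real (n choose card S))"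
        by (rule sum.mono_neutral_cong_right) (use fin in auto)
      also have "\<dots> = real (Suc n - card S) / real (n choose card S)"
      proof -
        have "card (A - S) = Suc n - card S"
          using card_Diff_subset[OF finite_subset[OF _ fin], of S A] S Suc.hyps(2) by simp
        then show ?thesis by simp
      qed
      also have "\<dots> = real (Suc n) * ?w A S"
      proof -
        have "(Suc n - card S) * (Suc n choose card S) = Suc n * (n choose card S)"
          using binomial_absorb_comp[of "Suc n" "card S"] by simp
        then have "real (Suc n - card S) * real (Suc n choose card S) = real (Suc n) * real (n choose card S)"
          by (metis of_nat_mult)
        moreover have "0 < real (Suc n choose card S)" "0 < real (n choose card S)"
          using c zero_less_binomial_iff[of "Suc n" "card S"] zero_less_binomial_iff[of n "card S"] by linarith+
        moreover have "x / y = z * (1 / t)" if "x * t = z * y" "0 < t" "0 < y" for x y z t :: real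
          using that by (simp add: field_simps)
        ultimately show ?thesis unfolding Suc.hyps(2)[symmetric] by blast
      qed
      finally show "(\<Sum>i\<in>A. if i \<in> S then 0 else 1 / real (n choose card S)) = real (Suc n) * ?w A S" .
    qed
    finally have "(\<Sum>i\<in>A. \<Sum>S\<in>?B (A - {i}) v. ?w (A - {i}) S) = real (Suc n) * (\<Sum>S\<in>?B A v - {A}. ?w A S)"
      unfolding sum_distrib_left .
    then show ?thesis by (simp only: nonzero_mult_div_cancel_left of_nat_eq_0_iff nat.distinct not_False_eq_True)
  qed
  \<comment> \<open>The condition \<open>u <= v' + s\<close> rather than \<open>u <= v'\<close> is
    what allows \<open>v' = v - s\<close> below, where only \<open>u <= F A <= v\<close> is
    known.\<close>
  have IH: "(\<Sum>S\<in>?B (A - {i}) v'. ?w (A - {i}) S) \<le> (v' - u) / s + 1" if "i \<in> A" "u \<le> v' + s" for i v'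
  proof (rule Suc.hyps(1))
    show "F S + s \<le> F (insert e S)" if "S \<subseteq> A - {i}" "e \<in> A - {i} - S" for S e
      by (rule Suc.prems(3)) (use that in blast)+
  qed (use Suc.hyps(2) that fin in simp_all)
  have avg_le: "(\<Sum>i\<in>A. \<Sum>S\<in>?B (A - {i}) v. ?w (A - {i}) S) / real (Suc n) \<le> t"
    if "\<And>i. i \<in> A \<Longrightarrow> (\<Sum>S\<in>?B (A - {i}) v. ?w (A - {i}) S) \<le> t" for t
  proof -
    have "(\<Sum>i\<in>A. \<Sum>S\<in>?B (A - {i}) v. ?w (A - {i}) S) \<le> (\<Sum>i\<in>A. t)" by (rule sum_mono) (rule that)
    also have "\<dots> = t * real (Suc n)" by (simp add: Suc.hyps(2)[symmetric] mult.commute)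
    finally show ?thesis by (simp only: pos_divide_le_eq of_nat_0_less_iff zero_less_Suc)
  qed
  show ?case
  proof (cases "A \<in> ?B A v")
    case False
    then have "?B A v - {A} = ?B A v" by auto
    then show ?thesis using avg avg_le[OF IH] Suc.prems(2) by (simp only: simp_thms)
  next
    case True
    have "(\<Sum>S\<in>?B (A - {i}) v. ?w (A - {i}) S) \<le> (v - u) / s" if i: "i \<in> A" for i
    proof -
      \<comment> \<open>A set that misses \<open>i\<close> reaches \<open>A\<close> through at least
        one insertion, so it lies at least one full step below \<open>F A\<close>.\<close>
      have mono: "F S + s \<le> F A" if "S \<subseteq> A - {i}" for S
        using that
      proof (induction "card (A - S)" arbitrary: S rule: less_induct)
        case less
        then have iS: "i \<in> A - S" using i by auto
        show ?case
        proof (cases "insert i S = A")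
          case True
          then show ?thesis using Suc.prems(3)[of S i] iS less.prems by auto
        next
          case False
          then obtain e where e: "e \<in> A - insert i S" using less.prems i by blast
          have "card (A - insert e S) < card (A - S)"
            using e fin by (intro psubset_card_mono) auto
          then have "F (insert e S) + s \<le> F A" using e less by auto
          moreover have "F S + s \<le> F (insert e S)" using Suc.prems(3)[of S e] e less.prems by auto
          ultimately show ?thesis using \<open>s > 0\<close> by linarith
        qed
      qed
      have eq: "?B (A - {i}) v = ?B (A - {i}) (v - s)"
      proof (rule Collect_cong)
        fix S
        show "S \<subseteq> A - {i} \<and> u \<le> F S \<and> F S \<le> v \<longleftrightarrow> S \<subseteq> A - {i} \<and> u \<le> F S \<and> F S \<le> v - s"
          using mono[of S] True \<open>s > 0\<close> by fastforce
      qed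
      have "(v - s - u) / s + 1 = (v - u) / s" using \<open>s > 0\<close> by (simp add: diff_divide_distrib)
      then show ?thesis
        unfolding eq using IH[OF i, of "v - s"] True by simp
    qed
    then have "(\<Sum>S\<in>?B A v - {A}. ?w A S) \<le> (v - u) / s"
      using avg avg_le[of "(v - u) / s"] by (simp only:)
    moreover have "(\<Sum>S\<in>?B A v. ?w A S) = ?w A A + (\<Sum>S\<in>?B A v - {A}. ?w A S)"
      by (rule sum.remove) (use True finB in auto)
    moreover have "?w A A = 1" by simp
    ultimately show ?thesis by linarith
  qed
qed

text \<open>The factor \<open>sqrt (n + 1)\<close> lets the induction over even \<open>n\<close>
  close without a further constant: it comes down to
  \<open>(2 m + 1) * (2 m + 3) <= 4 * (m + 1)^2\<close>. An odd central coefficient is half of the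
  next even one.\<close>

lemma central_binomial_upper: "real (n choose (n div 2)) * sqrt (real (n + 1)) \<le> 2 ^ n"
proof -
  have even: "real ((2 * m) choose m) * sqrt (real (2 * m + 1)) \<le> 4 ^ m" for m :: nat
  proof (induction m)
    case (Suc m)
    have "Suc m * ((2 * Suc m) choose Suc m) = 2 * (2 * m + 1) * ((2 * m) choose m)"
    proof -
      have "Suc m * ((2 * Suc m) choose Suc m) = (2 * m + 2) * (Suc (2 * m) choose m)"
        using Suc_times_binomial_eq[of "Suc (2 * m)" m] by (simp add: algebra_simps)
      also have "(Suc (2 * m) choose m) = (Suc (2 * m) choose Suc m)"
        using binomial_symmetric[of m "Suc (2 * m)"] by simp
      also have "(2 * m + 2) * (Suc (2 * m) choose Suc m) = 2 * (Suc m * (Suc (2 * m) choose Suc m))" by simp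
      also have "Suc m * (Suc (2 * m) choose Suc m) = Suc (2 * m) * ((2 * m) choose m)"
        using Suc_times_binomial_eq[of "2 * m" m] by (simp add: algebra_simps)
      finally show ?thesis by simp
    qed
    then have "real (Suc m) * real ((2 * Suc m) choose Suc m) = 2 * (2 * real m + 1) * real ((2 * m) choose m)"
      by (metis (mono_tags, lifting) of_nat_1 of_nat_add of_nat_mult of_nat_numeral)
    then have c: "real ((2 * Suc m) choose Suc m) = real ((2 * m) choose m) * (2 * (2 * real m + 1) / (real m + 1))"
      by (simp add: field_simps)
    \<comment> \<open>The ratio of consecutive even central binomial coefficients.\<close>
    define q where "q = 2 * (2 * real m + 1) / (real m + 1)"
    have "q * sqrt (real (2 * Suc m + 1)) \<le> 4 * sqrt (real (2 * m + 1))"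
    proof (rule power2_le_imp_le)
      have "(2 * real m + 1) * (2 * real m + 3) \<le> 4 * (real m + 1)\<^sup>2"
        by (simp add: power2_eq_square algebra_simps)
      then have "(2 * real m + 1) * ((2 * real m + 1) * (2 * real m + 3)) \<le> (2 * real m + 1) * (4 * (real m + 1)\<^sup>2)"
        by (intro mult_left_mono) auto
      then have "q\<^sup>2 * (2 * real m + 3) \<le> 16 * (2 * real m + 1)"
        unfolding q_def power_divide power_mult_distrib by (simp add: divide_simps) (simp add: power2_eq_square algebra_simps)
      then show "(q * sqrt (real (2 * Suc m + 1)))\<^sup>2 \<le> (4 * sqrt (real (2 * m + 1)))\<^sup>2"
        by (simp add: power_mult_distrib add.commute)
    qed simp
    then have "real ((2 * m) choose m) * (q * sqrt (real (2 * Suc m + 1)))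
       \<le> real ((2 * m) choose m) * (4 * sqrt (real (2 * m + 1)))"
      by (intro mult_left_mono) auto
    also have "\<dots> \<le> 4 * 4 ^ m" using Suc.IH by simp
    finally show ?case unfolding c q_def[symmetric] by (simp add: mult.assoc)
  qed simp
  show ?thesis
  proof (cases "even n")
    case True
    then obtain m where "n = 2 * m" by blast
    then show ?thesis using even[of m] by (simp add: power_mult)
  next
    case False
    then obtain m where n: "n = 2 * m + 1" by (metis oddE)
    have "(2 * Suc m) choose Suc m = 2 * (Suc (2 * m) choose m)"
      using binomial_symmetric[of m "Suc (2 * m)"] by simp
    then have "2 * real (Suc (2 * m) choose m) * sqrt (real (2 * m + 3)) \<le> 4 ^ Suc m"
      using even[of "Suc m"] by (simp add: algebra_simps)
    moreover have "real (Suc (2 * m) choose m) * sqrt (real (2 * m + 2)) \<le> real (Suc (2 * m) choose m) * sqrt (real (2 * m + 3))"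
      by (intro mult_left_mono) auto
    ultimately have "real (Suc (2 * m) choose m) * sqrt (real (2 * m + 2)) \<le> 2 * 4 ^ m"
      by (simp only: power_Suc mult.assoc)
    then show ?thesis unfolding n by (simp add: power_mult)
  qed
qed

text \<open>Every weight in \<open>LYM_interval\<close> is at least the reciprocal of the central
  binomial coefficient, so the weighted bound becomes a cardinality bound with the Littlewood-Offord
  rate \<open>1 / sqrt (card A + 1)\<close>.\<close>

lemma interval_count:
  fixes F :: "'a set \<Rightarrow> real"
  assumes "finite A" "s > 0" "u \<le> v + s"
    and step: "\<And>S e. S \<subseteq> A \<Longrightarrow> e \<in> A - S \<Longrightarrow> F S + s \<le> F (insert e S)"
  shows "real (card {S. S \<subseteq> A \<and> u \<le> F S \<and> F S \<le> v}) \<le> ((v - u) / s + 1) / sqrt (real (card A + 1)) * 2 ^ card A"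
proof -
  let ?n = "card A"
  let ?B = "{S. S \<subseteq> A \<and> u \<le> F S \<and> F S \<le> v}"
  let ?c = "real (?n choose (?n div 2))"
  have cpos: "?c > 0" by (simp add: zero_less_binomial_iff)
  have "real (card ?B) / ?c = (\<Sum>S\<in>?B. 1 / ?c)" by simp
  also have "\<dots> \<le> (\<Sum>S\<in>?B. 1 / real (?n choose card S))"
  proof (intro sum_mono divide_left_mono)
    fix S assume "S \<in> ?B"
    then have "card S \<le> ?n" using assms(1) by (auto intro: card_mono)
    then have "(?n choose card S) > 0" by (simp add: zero_less_binomial_iff)
    then show "0 < ?c * real (?n choose card S)" using cpos by simp
  qed (use binomial_maximum in auto)
  also have "\<dots> \<le> (v - u) / s + 1" using LYM_interval[OF assms(1-3), of F] step by blast
  finally have le: "real (card ?B) \<le> ((v - u) / s + 1) * ?c" using cpos by (simp add: field_simps)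
  have "?c \<le> 2 ^ ?n / sqrt (real (?n + 1))"
    using central_binomial_upper[of ?n] by (simp add: field_simps)
  moreover have "0 \<le> (v - u) / s + 1" using assms(2,3) by (simp add: field_simps)
  ultimately have "((v - u) / s + 1) * ?c \<le> ((v - u) / s + 1) * (2 ^ ?n / sqrt (real (?n + 1)))"
    by (intro mult_left_mono)
  with le show ?thesis by simp
qed

subsection \<open>Decision trees\<close>

lemma history_stop:
  assumes "A (history d A f n) = Output z" "n \<le> i"
  shows "history d A f i = history d A f n"
  using assms(2) by (induction i rule: dec_induct) (auto simp: assms(1))

lemma outputs_iff:
  assumes "A (history d A f n) = Output z"
  shows "outputs d A f z' \<longleftrightarrow> z' = z"
proof
  assume "outputs d A f z'"
  then obtain i where i: "A (history d A f i) = Output z'" by (auto simp: outputs_def)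
  show "z' = z"
  proof (cases "n \<le> i")
    case True
    have "history d A f i = history d A f n" by (rule history_stop) (use assms True in auto)
    then show ?thesis using i assms by simp
  next
    case False
    have "history d A f n = history d A f i" by (rule history_stop) (use i False in auto)
    then show ?thesis using i assms by simp
  qed
qed (use assms in \<open>auto simp: outputs_def\<close>)

text \<open>The history freezes once an output is produced, so stopping after at most
  \<open>n\<close> queries can be read off at stage \<open>n\<close> itself.\<close>

lemma num_queries_le_iff:
  "num_queries d A f \<le> enat n \<longleftrightarrow> (\<exists>z. A (history d A f n) = Output z)"
proof
  assume le: "num_queries d A f \<le> enat n"
  let ?N = "{enat i | i. \<exists>z. A (history d A f i) = Output z}"
  have ne: "?N \<noteq> {}"
  proof
    assume "?N = {}"
    then have "num_queries d A f = \<infinity>" unfolding num_queries_def by (simp add: top_enat_def)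
    then show False using le by simp
  qed
  then have "num_queries d A f = (LEAST x. x \<in> ?N)"
    unfolding num_queries_def Inf_enat_def by (rule if_not_P)
  moreover have "(LEAST x. x \<in> ?N) \<in> ?N" using ne LeastI_ex[of "\<lambda>x. x \<in> ?N"] by blast
  ultimately have "num_queries d A f \<in> ?N" by simp
  then obtain i z where i: "num_queries d A f = enat i" "A (history d A f i) = Output z" by blast
  then have "history d A f n = history d A f i" using le by (intro history_stop) auto
  then show "\<exists>z. A (history d A f n) = Output z" using i by auto
next
  assume "\<exists>z. A (history d A f n) = Output z"
  then show "num_queries d A f \<le> enat n" unfolding num_queries_def by (intro Inf_lower) auto
qed

text \<open>One branching of the decision tree: \<open>T\<close> is the set of newly revealed
  elements and \<open>X\<close> the trace of the hidden set on it.\<close>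

lemma card_subsets_split:
  assumes "finite B" "T \<subseteq> B"
  shows "card {S. S \<subseteq> B \<and> P S} = (\<Sum>X\<in>Pow T. card {S. S \<subseteq> B - T \<and> P (X \<union> S)})"
proof -
  have finT: "finite T" using assms finite_subset by blast
  have "bij_betw (\<lambda>(X, S). X \<union> S) (SIGMA X:Pow T. {S. S \<subseteq> B - T \<and> P (X \<union> S)}) {S. S \<subseteq> B \<and> P S}"
  proof (rule bij_betwI[where g = "\<lambda>S. (S \<inter> T, S - T)"])
    fix S assume "S \<in> {S. S \<subseteq> B \<and> P S}"
    then show "(\<lambda>(X, S). X \<union> S) (S \<inter> T, S - T) = S" by auto
  qed (use assms(2) in \<open>auto simp: Int_Diff_Un Un_Diff_Int Un_commute\<close>)
  then have "card {S. S \<subseteq> B \<and> P S} = card (SIGMA X:Pow T. {S. S \<subseteq> B - T \<and> P (X \<union> S)})"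
    using bij_betw_same_card by fastforce
  then show ?thesis using finT assms(1) by (simp add: card_SigmaI)
qed

text \<open>A strategy is followed down its decision tree: while it runs, the hidden sets consistent with
  the answers form a subcube, in which only the at most \<open>w\<close> elements seen per query are fixed.\<close>

lemma decision_tree_count:
  fixes F :: "'a set \<Rightarrow> point \<Rightarrow> real" and \<theta> :: real
  assumes fin: "finite U"
    and query: "\<And>h x. A h = Query x \<Longrightarrow> x \<in> euclid d"
    and local: "\<And>b b' x. b \<subseteq> U \<Longrightarrow> b' \<subseteq> U \<Longrightarrow> x \<in> euclid d \<Longrightarrow> b \<inter> Q x = b' \<inter> Q x \<Longrightarrow>
      F b x = F b' x \<and> gradient d (F b) x = gradient d (F b') x"
    and width: "\<And>x. x \<in> euclid d \<Longrightarrow> card (Q x \<inter> U) \<le> w"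
    and leaf: "\<And>R c z. R \<subseteq> U \<Longrightarrow> c \<subseteq> R \<Longrightarrow> card R \<le> n * w \<Longrightarrow>
      real (card {S. S \<subseteq> U - R \<and> good (c \<union> S) z}) \<le> \<theta> * 2 ^ card (U - R)"
    and halt: "\<And>b. b \<subseteq> U \<Longrightarrow> \<exists>z. A (history d A (F b) n) = Output z"
  shows "real (card {b. b \<subseteq> U \<and> (\<exists>z. outputs d A (F b) z \<and> good b z)}) \<le> \<theta> * 2 ^ card U"
proof -
  let ?succ = "\<lambda>b. \<exists>z. outputs d A (F b) z \<and> good b z"
  \<comment> \<open>Invariant at a node: \<open>R\<close> contains all revealed elements,
    \<open>c\<close> is the trace of the hidden set on \<open>R\<close>, \<open>h\<close> is the
    history shared by the whole subcube, and \<open>j\<close> bounds the remaining depth.\<close>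
  have main: "real (card {S. S \<subseteq> U - R \<and> ?succ (c \<union> S)}) \<le> \<theta> * 2 ^ card (U - R)"
    if "i + j = n" "R \<subseteq> U" "c \<subseteq> R" "card R \<le> i * w"
      "\<And>S. S \<subseteq> U - R \<Longrightarrow> history d A (F (c \<union> S)) i = h" for i j R c h
    using that
  proof (induction j arbitrary: i R c h)
    case (0 i R c h)
    obtain z where z: "A h = Output z"
      using halt[of c] 0(1,2,3) 0(5)[of "{}"] by auto
    have "outputs d A (F (c \<union> S)) z' \<longleftrightarrow> z' = z" if "S \<subseteq> U - R" for S z'
      using 0(5)[OF that] z by (intro outputs_iff[of _ _ _ i]) auto
    then have "{S. S \<subseteq> U - R \<and> ?succ (c \<union> S)} = {S. S \<subseteq> U - R \<and> good (c \<union> S) z}" by auto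
    then show ?case using leaf 0 by simp
  next
    case (Suc j i R c h)
    show ?case
    proof (cases "A h")
      \<comment> \<open>A strategy that stops early ends in a larger subcube, and
        \<open>leaf\<close> still applies because \<open>card R <= i * w <= n * w\<close>.\<close>
      case (Output z)
      have "outputs d A (F (c \<union> S)) z' \<longleftrightarrow> z' = z" if "S \<subseteq> U - R" for S z'
        using Suc.prems(5)[OF that] Output by (intro outputs_iff[of _ _ _ i]) auto
      then have "{S. S \<subseteq> U - R \<and> ?succ (c \<union> S)} = {S. S \<subseteq> U - R \<and> good (c \<union> S) z}" by auto
      moreover have "card R \<le> n * w"
        using Suc.prems(1,4) mult_right_mono[of i n w] by linarith
      ultimately show ?thesis using leaf Suc.prems(2,3) by simp
    next
      case (Query x)
      have x: "x \<in> euclid d" using query Query by blast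
      define T where "T = Q x \<inter> (U - R)"
      have TU: "T \<subseteq> U - R" by (auto simp: T_def)
      have finT: "finite T" using TU fin finite_subset by blast
      have RT: "U - R - T = U - (R \<union> T)" by auto
      \<comment> \<open>Fixing the trace \<open>X\<close> on \<open>T\<close> determines the answer
        at \<open>x\<close>, so the history stays constant on each of these smaller
        subcubes.\<close>
      have each: "real (card {S. S \<subseteq> U - (R \<union> T) \<and> ?succ (c \<union> (X \<union> S))}) \<le> \<theta> * 2 ^ card (U - (R \<union> T))"
        if X: "X \<subseteq> T" for X
      proof -
        have "real (card {S. S \<subseteq> U - (R \<union> T) \<and> ?succ ((c \<union> X) \<union> S)}) \<le> \<theta> * 2 ^ card (U - (R \<union> T))"
        proof (rule Suc.IH[of "Suc i"])
          show "Suc i + j = n" using Suc.prems by simp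
          show "R \<union> T \<subseteq> U" "c \<union> X \<subseteq> R \<union> T" using Suc.prems TU X by auto
          have "card T \<le> card (Q x \<inter> U)" using fin by (intro card_mono) (auto simp: T_def)
          also have "\<dots> \<le> w" by (rule width[OF x])
          finally show "card (R \<union> T) \<le> Suc i * w"
            using card_Un_le[of R T] Suc.prems(4) by simp
          fix S assume S: "S \<subseteq> U - (R \<union> T)"
          have hS: "history d A (F (c \<union> (X \<union> S))) i = h" using S X TU by (intro Suc.prems(5)) auto
          have "F (c \<union> (X \<union> S)) x = F (c \<union> X) x \<and> gradient d (F (c \<union> (X \<union> S))) x = gradient d (F (c \<union> X)) x"
            using S X TU Suc.prems(2,3) by (intro local x) (auto simp: T_def)
          then show "history d A (F ((c \<union> X) \<union> S)) (Suc i) = h @ [(x, F (c \<union> X) x, gradient d (F (c \<union> X)) x)]"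
            using hS Query by (simp add: Un_assoc)
        qed
        then show ?thesis by (simp add: Un_assoc)
      qed
      have "real (card {S. S \<subseteq> U - R \<and> ?succ (c \<union> S)})
          = (\<Sum>X\<in>Pow T. real (card {S. S \<subseteq> U - (R \<union> T) \<and> ?succ (c \<union> (X \<union> S))}))"
        using card_subsets_split[OF _ TU, of "\<lambda>S. ?succ (c \<union> S)"] fin by (simp add: RT)
      also have "\<dots> \<le> (\<Sum>X\<in>Pow T. \<theta> * 2 ^ card (U - (R \<union> T)))" by (intro sum_mono each) auto
      also have "\<dots> = \<theta> * (2 ^ card T * 2 ^ card (U - (R \<union> T)))" using finT by (simp add: card_Pow)
      also have "(2::real) ^ card T * 2 ^ card (U - (R \<union> T)) = 2 ^ card (U - R)"
      proof -
        have "card (U - R) = card T + card (U - (R \<union> T))"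
          using card_Diff_subset[OF finT TU] card_mono[OF _ TU] fin unfolding RT by simp
        then show ?thesis by (simp add: power_add)
      qed
      finally show ?thesis .
    qed
  qed
  from main[of 0 n "{}" "{}" "[]"] show ?thesis by simp
qed

text \<open>The easy half of Yao's principle: if every deterministic outcome \<open>\<omega>\<close>
  succeeds on at most a fraction \<open>\<theta>\<close> of the instances, then the average success
  probability over the instances is at most \<open>\<theta>\<close>, and some instance does not
  exceed the average.\<close>

lemma (in prob_space) exists_unlikely_event:
  fixes \<theta> :: real
  assumes "finite I" "I \<noteq> {}" "\<theta> \<ge> 0"
    and count: "\<And>\<omega>. \<omega> \<in> space M \<Longrightarrow> real (card {i \<in> I. E i \<omega>}) \<le> \<theta> * real (card I)"
  shows "\<exists>i\<in>I. measure M {\<omega> \<in> space M. E i \<omega>} \<le> \<theta>"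
proof (rule ccontr)
  assume "\<not> ?thesis"
  then have gt: "measure M {\<omega> \<in> space M. E i \<omega>} > \<theta>" if "i \<in> I" for i using that by force
  \<comment> \<open>Measurability comes for free under the contrary assumption, since a
    non-measurable set has \<open>measure\<close> zero.\<close>
  have meas [measurable]: "{\<omega> \<in> space M. E i \<omega>} \<in> sets M" if "i \<in> I" for i
    using gt[OF that] assms(3) measure_notin_sets by force
  have "\<theta> * real (card I) = (\<Sum>i\<in>I. \<theta>)" by simp
  also have "\<dots> < (\<Sum>i\<in>I. measure M {\<omega> \<in> space M. E i \<omega>})"
    using assms gt by (intro sum_strict_mono) auto
  also have "\<dots> = (\<Sum>i\<in>I. \<integral>\<omega>. indicator {\<omega> \<in> space M. E i \<omega>} \<omega> \<partial>M)"
    using meas by (intro sum.cong) auto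
  also have "\<dots> = (\<integral>\<omega>. (\<Sum>i\<in>I. indicator {\<omega> \<in> space M. E i \<omega>} \<omega>) \<partial>M)"
    using meas by (intro Bochner_Integration.integral_sum[symmetric]) (simp add: integrable_indicator_iff less_top[symmetric])
  also have "\<dots> \<le> (\<integral>\<omega>. \<theta> * real (card I) \<partial>M)"
  proof (rule integral_mono)
    show "integrable M (\<lambda>\<omega>. \<Sum>i\<in>I. indicat_real {\<omega> \<in> space M. E i \<omega>} \<omega>)"
      using meas by (intro Bochner_Integration.integrable_sum) (simp add: integrable_indicator_iff less_top[symmetric])
    fix \<omega> assume \<omega>: "\<omega> \<in> space M"
    have "(\<Sum>i\<in>I. indicat_real {\<omega> \<in> space M. E i \<omega>} \<omega>) = (\<Sum>i\<in>I. if E i \<omega> then 1 else 0)"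
      using \<omega> by (intro sum.cong) auto
    also have "\<dots> = real (card {i \<in> I. E i \<omega>})" using assms(1) by (simp add: sum.If_cases Int_def)
    finally show "(\<Sum>i\<in>I. indicat_real {\<omega> \<in> space M. E i \<omega>} \<omega>) \<le> \<theta> * real (card I)"
      using count[OF \<omega>] by simp
  qed simp
  finally show False by (simp add: prob_space)
qed

subsection \<open>Gradients and quadratic remainders\<close>

text \<open>Second-order remainder of the clipped square of \<open>r\<close> minus the squared
  distance to a center. Here \<open>a\<close> and \<open>b\<close> are the squared distances of two
  points to the center, \<open>D\<close> is the squared distance between the points, and
  \<open>I\<close> is the inner product of the first offset with the displacement; the bound on
  \<open>I\<close> is Cauchy-Schwarz.\<close>

lemma clipped_square_remainder:
  fixes a b D I r :: real
  assumes "0 \<le> a" "0 \<le> b" "0 \<le> D" "0 \<le> r" "I\<^sup>2 \<le> a * D" "b = a + 2 * I + D"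
  shows "\<bar>(max 0 (r - b))\<^sup>2 - (max 0 (r - a))\<^sup>2 + 4 * max 0 (r - a) * I\<bar> \<le> 10 * r * D"
proof -
  \<comment> \<open>By Cauchy-Schwarz from either endpoint, \<open>(2 * I + D)^2\<close> is at most
    \<open>8 * a * D + 2 * D^2\<close> and at most \<open>8 * b * D + 2 * D^2\<close>, so it is
    enough that one endpoint lies within the radius.\<close>
  have diff: "(b - a)\<^sup>2 \<le> 10 * r * D" if "D \<le> r" "a \<le> r \<or> b \<le> r"
  proof -
    have *: "(2 * I + D)\<^sup>2 \<le> 8 * a * D + 2 * D\<^sup>2"
      using assms(5) sum_squares_ge_zero[of "2 * I - D" 0] by (simp add: power2_eq_square algebra_simps)
    have "(I + D)\<^sup>2 \<le> b * D"
      using assms(5) unfolding assms(6) by (simp add: power2_eq_square algebra_simps)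
    moreover have "(2 * I + D)\<^sup>2 \<le> 8 * (I + D)\<^sup>2 + 2 * D\<^sup>2"
      using sum_squares_ge_zero[of "2 * I + 3 * D" 0] by (simp add: power2_eq_square algebra_simps)
    ultimately have **: "(2 * I + D)\<^sup>2 \<le> 8 * b * D + 2 * D\<^sup>2" by linarith
    have "D\<^sup>2 \<le> r * D" unfolding power2_eq_square using that assms by (intro mult_right_mono) auto
    moreover have "a * D \<le> r * D \<or> b * D \<le> r * D" using that assms by (auto intro: mult_right_mono)
    ultimately have "(2 * I + D)\<^sup>2 \<le> 10 * r * D" using * ** by linarith
    then show ?thesis unfolding assms(6) by (simp add: algebra_simps)
  qed
  have rD: "0 \<le> r * D" using assms by simp
  consider "a \<ge> r" "b \<ge> r" | "a \<ge> r" "b < r" "D \<ge> r" | "a \<ge> r" "b < r" "D < r" | "a < r" "D \<ge> r" | "a < r" "D < r"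
    by linarith
  then show ?thesis
  proof cases
    case 1 then show ?thesis using rD by (simp add: mult.commute)
  next
    case 2
    have "(r - b)\<^sup>2 \<le> r\<^sup>2" using 2 assms by (intro power_mono) auto
    also have "\<dots> \<le> r * D" unfolding power2_eq_square using 2 assms by (intro mult_left_mono) auto
    finally show ?thesis using 2 rD by simp
  next
    case 3
    have "(r - b)\<^sup>2 \<le> (a - b)\<^sup>2" using 3 by (intro power_mono) auto
    also have "\<dots> \<le> 10 * r * D" using diff 3 by (simp add: power2_commute)
    finally show ?thesis using 3 by simp
  next
    case 4
    have r2: "r\<^sup>2 \<le> r * D" unfolding power2_eq_square using 4 assms by (intro mult_left_mono) auto
    have U: "0 \<le> (max 0 (r - t))\<^sup>2 \<and> (max 0 (r - t))\<^sup>2 \<le> r\<^sup>2" if "0 \<le> t" for t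
      using that assms by (auto intro!: power_mono)
    have "I\<^sup>2 \<le> D\<^sup>2"
    proof -
      have "a * D \<le> D * D" using 4 assms by (intro mult_right_mono) auto
      then show ?thesis using assms(5) by (simp add: power2_eq_square)
    qed
    then have "\<bar>I\<bar> \<le> D" using assms(3) by (simp add: abs_le_square_iff[symmetric])
    then have "\<bar>(r - a) * I\<bar> \<le> r * D" unfolding abs_mult using 4 assms by (intro mult_mono) auto
    moreover have "4 * max 0 (r - a) * I = 4 * ((r - a) * I)" using 4 by simp
    ultimately show ?thesis using r2 U[OF assms(1)] U[OF assms(2)] rD by linarith
  next
    case 5
    have d: "(b - a)\<^sup>2 \<le> 10 * r * D" using diff 5 by simp
    \<comment> \<open>First-order Taylor remainder, at \<open>a\<close>, of the function sending
      \<open>t\<close> to the square of \<open>max 0 (r - t)\<close>.\<close>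
    have rem: "0 \<le> (max 0 (r - b))\<^sup>2 - (r - a)\<^sup>2 + 2 * (r - a) * (b - a)
       \<and> (max 0 (r - b))\<^sup>2 - (r - a)\<^sup>2 + 2 * (r - a) * (b - a) \<le> (b - a)\<^sup>2"
    proof (cases "b \<le> r")
      case True
      then have "(max 0 (r - b))\<^sup>2 - (r - a)\<^sup>2 + 2 * (r - a) * (b - a) = (b - a)\<^sup>2"
        by (simp add: power2_eq_square algebra_simps)
      then show ?thesis by simp
    next
      case False
      have "0 \<le> (r - a) * (b - r)" using 5 False by simp
      moreover have "0 \<le> (r - a) * (r - a)" by simp
      moreover have "0 \<le> (b - r) * (b - r)" by simp
      ultimately show ?thesis using False by (simp add: power2_eq_square algebra_simps)
    qed
    \<comment> \<open>Replacing \<open>b - a\<close> by its linear part \<open>2 * I\<close> costs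
      \<open>2 * (r - a) * D\<close>, which is at most \<open>2 * r * D\<close> and enters with a
      negative sign.\<close>
    have e: "4 * (r - a) * I = 2 * (r - a) * (b - a) - 2 * ((r - a) * D)"
      unfolding assms(6) by (simp add: algebra_simps)
    have "0 \<le> (r - a) * D" "(r - a) * D \<le> r * D" using 5 assms by (auto intro: mult_right_mono)
    moreover have "max 0 (r - a) = r - a" using 5 by simp
    ultimately show ?thesis using rem d rD e by (simp only: abs_le_iff) linarith
  qed
qed

text \<open>Testing along coordinate directions fixes the entries below \<open>d\<close>, and
  extensionality fixes the others. This is what gives the \<open>THE\<close> in
  \<open>gradient\<close> its value.\<close>

lemma has_gradient_unique:
  assumes x: "x \<in> euclid d" and g: "has_gradient d f x g" and h: "has_gradient d f x h"
  shows "g = h"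
proof
  fix i
  show "g i = h i"
  proof (cases "i < d")
    case False
    then show ?thesis using g h by (auto simp: has_gradient_def euclid_def PiE_def extensional_def)
  next
    case i: True
    show ?thesis
    proof (rule ccontr)
      assume ne: "g i \<noteq> h i"
      \<comment> \<open>The two error terms add up to \<open>2 * e * t\<close>, half of what the
        discrepancy of the entries would require.\<close>
      define e where "e = \<bar>g i - h i\<bar> / 4"
      have e: "e > 0" using ne by (simp add: e_def)
      obtain \<delta>1 where 1: "\<delta>1 > 0" "\<And>y. y \<in> euclid d \<Longrightarrow> edist d y x < \<delta>1 \<Longrightarrow>
          \<bar>f y - f x - (\<Sum>i<d. g i * (y i - x i))\<bar> \<le> e * edist d y x"
        using g e unfolding has_gradient_def by meson
      obtain \<delta>2 where 2: "\<delta>2 > 0" "\<And>y. y \<in> euclid d \<Longrightarrow> edist d y x < \<delta>2 \<Longrightarrow>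
          \<bar>f y - f x - (\<Sum>i<d. h i * (y i - x i))\<bar> \<le> e * edist d y x"
        using h e unfolding has_gradient_def by meson
      define t where "t = min \<delta>1 \<delta>2 / 2"
      have t: "t > 0" "t < \<delta>1" "t < \<delta>2" using 1 2 by (auto simp: t_def)
      let ?y = "x(i := x i + t)"
      have y: "?y \<in> euclid d" using x i by (auto simp: euclid_def PiE_def extensional_def)
      have s: "(\<Sum>j<d. c j * (?y j - x j)) = c i * t" for c :: "nat \<Rightarrow> real"
      proof -
        have "(\<Sum>j<d. c j * (?y j - x j)) = (\<Sum>j<d. if j = i then c i * t else 0)"
          by (intro sum.cong) auto
        then show ?thesis using i by simp
      qed
      have ed: "edist d ?y x = t"
      proof -
        have "(\<Sum>j<d. (?y j - x j)\<^sup>2) = (\<Sum>j<d. if j = i then t\<^sup>2 else 0)"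
          by (intro sum.cong) auto
        then show ?thesis using i t by (simp add: edist_def L2_set_def)
      qed
      have "\<bar>f ?y - f x - g i * t\<bar> \<le> e * t" "\<bar>f ?y - f x - h i * t\<bar> \<le> e * t"
        using 1(2)[OF y] 2(2)[OF y] ed t unfolding s by auto
      then have "\<bar>g i * t - h i * t\<bar> \<le> 2 * e * t" by linarith
      then have "\<bar>g i - h i\<bar> * t \<le> 2 * e * t" using t by (simp add: left_diff_distrib[symmetric] abs_mult)
      then show False using t ne by (simp add: e_def mult_le_0_iff)
    qed
  qed
qed

lemma gradient_eqI:
  assumes "x \<in> euclid d" "has_gradient d f x g"
  shows "gradient d f x = g"
  unfolding gradient_def using assms has_gradient_unique by (intro the_equality) auto

section \<open>Euclidean distance and a criterion for membership in the class\<close>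

lemma edist_power2: "(edist d x y)\<^sup>2 = (\<Sum>i<d. (x i - y i)\<^sup>2)"
  unfolding edist_def L2_set_def by (simp add: sum_nonneg)

lemma edist_commute: "edist d x y = edist d y x"
  unfolding edist_def by (simp add: L2_set_def power2_commute)

lemma edist_nonneg: "0 \<le> edist d x y"
  unfolding edist_def by simp

lemma has_gradient_quadratic_remainder:
  assumes "g \<in> euclid d" "C \<ge> 0"
    and "\<And>y. y \<in> euclid d \<Longrightarrow> \<bar>f y - f x - (\<Sum>i<d. g i * (y i - x i))\<bar> \<le> C * (edist d y x)\<^sup>2"
  shows "has_gradient d f x g"
  unfolding has_gradient_def
proof (intro conjI allI impI assms(1))
  fix e :: real assume e: "e > 0"
  show "\<exists>\<delta>>0. \<forall>y\<in>euclid d. edist d y x < \<delta> \<longrightarrow>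
        \<bar>f y - f x - (\<Sum>i<d. g i * (y i - x i))\<bar> \<le> e * edist d y x"
  proof (intro exI[of _ "e / (C + 1)"] conjI ballI impI)
    fix y assume y: "y \<in> euclid d" "edist d y x < e / (C + 1)"
    have "C * (edist d y x)\<^sup>2 \<le> ((C + 1) * edist d y x) * edist d y x"
      using edist_nonneg[of d y x] by (simp add: power2_eq_square algebra_simps)
    also have "\<dots> \<le> e * edist d y x"
      using y assms(2) edist_nonneg by (intro mult_right_mono) (auto simp: field_simps)
    finally show "\<bar>f y - f x - (\<Sum>i<d. g i * (y i - x i))\<bar> \<le> e * edist d y x"
      using assms(3)[OF y(1)] by linarith
  qed (use e assms in auto)
qed

text \<open>Two-sided quadratic bounds with any candidate field \<open>g\<close> already force
  differentiability with gradient \<open>g\<close>, so no derivative has to be computed by calculus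
  rules.\<close>

lemma strongly_convex_smoothI:
  assumes g: "\<And>x. x \<in> euclid d \<Longrightarrow> g x \<in> euclid d"
    and rem: "\<And>x y. x \<in> euclid d \<Longrightarrow> y \<in> euclid d \<Longrightarrow>
      \<mu> / 2 * (edist d x y)\<^sup>2 \<le> f y - f x - (\<Sum>i<d. g x i * (y i - x i)) \<and>
      f y - f x - (\<Sum>i<d. g x i * (y i - x i)) \<le> L / 2 * (edist d x y)\<^sup>2"
  shows "f \<in> strongly_convex_smooth \<mu> L d"
    and "\<And>x. x \<in> euclid d \<Longrightarrow> gradient d f x = g x"
proof -
  have hg: "has_gradient d f x (g x)" if x: "x \<in> euclid d" for x
  proof (rule has_gradient_quadratic_remainder[of _ _ "(\<bar>\<mu>\<bar> + \<bar>L\<bar>)"])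
    fix y assume y: "y \<in> euclid d"
    have "- ((\<bar>\<mu>\<bar> + \<bar>L\<bar>)) \<le> \<mu> / 2"
      by linarith
    then have "- ((\<bar>\<mu>\<bar> + \<bar>L\<bar>)) * (edist d x y)\<^sup>2 \<le> \<mu> / 2 * (edist d x y)\<^sup>2"
      by (rule mult_right_mono) simp
    moreover have "L / 2 * (edist d x y)\<^sup>2 \<le> (\<bar>\<mu>\<bar> + \<bar>L\<bar>) * (edist d x y)\<^sup>2"
      by (rule mult_right_mono) auto
    ultimately show "\<bar>f y - f x - (\<Sum>i<d. g x i * (y i - x i))\<bar> \<le> (\<bar>\<mu>\<bar> + \<bar>L\<bar>) * (edist d y x)\<^sup>2"
      using rem[OF x y] by (simp add: edist_commute[of d y x] abs_le_iff; linarith)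
  qed (use g x in auto)
  show gr: "gradient d f x = g x" if "x \<in> euclid d" for x
    using gradient_eqI hg that by blast
  show "f \<in> strongly_convex_smooth \<mu> L d"
    unfolding strongly_convex_smooth_def using hg rem gr by auto
qed

subsection \<open>Gaussian potentials with bumps\<close>

text \<open>There are \<open>m\<close> blocks of \<open>k\<close> coordinates, and each axis of a
  block is cut into \<open>p\<close> pieces. Coordinates beyond \<open>m * k\<close> carry only the
  quadratic term.\<close>

locale bump_grid =
  fixes k m p d :: nat
  assumes k: "0 < k" and p: "0 < p" and md: "m * k \<le> d"
begin

definition block :: "nat \<Rightarrow> nat set" where
  "block j = {j * k..<j * k + k}"

definition cells :: "(nat \<times> (nat \<Rightarrow> nat)) set" where
  "cells = (SIGMA j:{..<m}. block j \<rightarrow>\<^sub>E {..<p})"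

text \<open>The square of half the grid spacing, so that the balls supporting the bumps of one block are disjoint.\<close>

definition r :: real where
  "r = 1 / (4 * (real p)\<^sup>2)"

definition center :: "nat \<times> (nat \<Rightarrow> nat) \<Rightarrow> point" where
  "center e l = (real (snd e l) + 1 / 2) / real p"

definition sqdist :: "nat \<times> (nat \<Rightarrow> nat) \<Rightarrow> point \<Rightarrow> real" where
  "sqdist e x = (\<Sum>l\<in>block (fst e). (x l - center e l)\<^sup>2)"

text \<open>Squaring the clipped term makes the bump continuously differentiable, and dividing by
  \<open>80 * r\<close> scales the remainder constant \<open>10 * r\<close> down to
  \<open>1 / 8\<close>.\<close>

definition bump :: "nat \<times> (nat \<Rightarrow> nat) \<Rightarrow> point \<Rightarrow> real" where
  "bump e x = (max 0 (r - sqdist e x))\<^sup>2 / (80 * r)"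

definition bump_grad :: "nat \<times> (nat \<Rightarrow> nat) \<Rightarrow> point \<Rightarrow> point" where
  "bump_grad e x l = (if l \<in> block (fst e) then - (max 0 (r - sqdist e x) * (x l - center e l)) / (20 * r) else 0)"

definition pot :: "(nat \<times> (nat \<Rightarrow> nat)) set \<Rightarrow> point \<Rightarrow> real" where
  "pot b x = (\<Sum>l<d. (x l)\<^sup>2) / 2 + (\<Sum>e\<in>b. bump e x)"

definition pot_grad :: "(nat \<times> (nat \<Rightarrow> nat)) set \<Rightarrow> point \<Rightarrow> point" where
  "pot_grad b x = restrict (\<lambda>l. x l + (\<Sum>e\<in>b. bump_grad e x l)) {..<d}"

text \<open>The bits of the hidden set that a query at \<open>x\<close> can reveal.\<close>

definition active :: "point \<Rightarrow> (nat \<times> (nat \<Rightarrow> nat)) set" where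
  "active x = {e \<in> cells. sqdist e x < r}"

section \<open>Geometry of blocks, cells and active bumps\<close>

lemma r_pos: "0 < r"
  using p by (simp add: r_def)

lemma r_le: "r \<le> 1"
  using p by (simp add: r_def field_simps) (smt (verit) one_le_power of_nat_1 of_nat_le_iff Suc_leI One_nat_def)

lemma finite_block [simp]: "finite (block j)" and card_block [simp]: "card (block j) = k"
  by (simp_all add: block_def)

lemma finite_cells [simp]: "finite cells"
  unfolding cells_def by (intro finite_SigmaI finite_PiE) auto

lemma card_cells: "card cells = m * p ^ k"
  unfolding cells_def by (simp add: card_SigmaI card_PiE finite_PiE)

lemma block_subset: "j < m \<Longrightarrow> block j \<subseteq> {..<d}"
proof -
  assume "j < m"
  then have "Suc j * k \<le> m * k" by (intro mult_right_mono) auto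
  then show ?thesis using md by (auto simp: block_def)
qed

lemma block_disjoint: "i \<noteq> j \<Longrightarrow> block i \<inter> block j = {}"
proof -
  have "block i \<inter> block j = {}" if "i < j" for i j
  proof -
    have "Suc i * k \<le> j * k" using that by (intro mult_right_mono) auto
    then show ?thesis by (auto simp: block_def)
  qed
  then show "i \<noteq> j \<Longrightarrow> block i \<inter> block j = {}" by (metis Int_commute nat_neq_iff)
qed

lemma cells_fst: "e \<in> cells \<Longrightarrow> fst e < m"
  by (auto simp: cells_def)

lemma cells_block: "e \<in> cells \<Longrightarrow> block (fst e) \<subseteq> {..<d}"
  using cells_fst block_subset by blast

lemma sqdist_nonneg: "0 \<le> sqdist e x"
  by (simp add: sqdist_def sum_nonneg)

lemma bump_nonneg: "0 \<le> bump e x"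
  using r_pos by (simp add: bump_def)

lemma bump_le: "bump e x \<le> r / 80"
proof -
  have "(max 0 (r - sqdist e x))\<^sup>2 \<le> r\<^sup>2"
    using r_pos sqdist_nonneg[of e x] by (intro power_mono) auto
  then show ?thesis using r_pos by (simp add: bump_def field_simps power2_eq_square)
qed

lemma bump_inactive: "e \<in> cells \<Longrightarrow> e \<notin> active x \<Longrightarrow> bump e x = 0"
  and bump_grad_inactive: "e \<in> cells \<Longrightarrow> e \<notin> active x \<Longrightarrow> bump_grad e x l = 0"
  by (auto simp: active_def bump_def bump_grad_def max_def)

text \<open>An active center is closer than \<open>1 / (2 p)\<close> to \<open>x\<close> in each
  coordinate of its block, whereas two different centers of one block are at least
  \<open>1 / p\<close> apart in some coordinate.\<close>

lemma inj_on_active: "inj_on fst (active x)"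
proof (rule inj_onI)
  fix e e' assume e: "e \<in> active x" "e' \<in> active x" "fst e = fst e'"
  have near: "\<bar>x l - center e l\<bar> < 1 / (2 * real p)" if "e \<in> active x" "l \<in> block (fst e)" for e l
  proof -
    have "(x l - center e l)\<^sup>2 \<le> sqdist e x"
      unfolding sqdist_def using that by (intro member_le_sum) auto
    also have "\<dots> < (1 / (2 * real p))\<^sup>2" using that by (simp add: active_def r_def power_divide power_mult_distrib)
    finally have "\<bar>x l - center e l\<bar>\<^sup>2 < (1 / (2 * real p))\<^sup>2" by simp
    then show ?thesis by (rule power2_less_imp_less) simp
  qed
  have "snd e = snd e'"
  proof (rule PiE_ext)
    show "snd e \<in> block (fst e) \<rightarrow>\<^sub>E {..<p}" "snd e' \<in> block (fst e) \<rightarrow>\<^sub>E {..<p}"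
      using e by (auto simp: active_def cells_def)
    fix l assume l: "l \<in> block (fst e)"
    have "\<bar>u - v\<bar> < h + h" if "\<bar>t - u\<bar> < h" "\<bar>t - v\<bar> < h" for t u v h :: real
      using that by linarith
    then have "\<bar>center e l - center e' l\<bar> < 1 / (2 * real p) + 1 / (2 * real p)"
      using near[OF e(1) l] near[OF e(2), of l] l e(3) by metis
    also have "\<dots> = 1 / real p" by simp
    finally have "\<bar>real (snd e l) - real (snd e' l)\<bar> < 1"
      using p by (simp add: center_def diff_divide_distrib[symmetric] abs_divide field_simps)
    then show "snd e l = snd e' l" by linarith
  qed
  then show "e = e'" using e(3) by (simp add: prod_eq_iff)
qed

lemma active_eq: "e \<in> active x \<Longrightarrow> e' \<in> active x \<Longrightarrow> fst e = fst e' \<Longrightarrow> e = e'"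
  using inj_on_active by (auto dest: inj_onD)

lemma active_subset: "active x \<subseteq> cells" and finite_active [simp]: "finite (active x)"
  using finite_subset[of "active x" cells] by (auto simp: active_def)

lemma card_active: "card (active x) \<le> m"
proof -
  have "card (active x) = card (fst ` active x)" using card_image[OF inj_on_active] by simp
  also have "\<dots> \<le> card {..<m}" using active_subset cells_fst by (intro card_mono) auto
  finally show ?thesis by simp
qed

lemma bump_remainder:
  assumes "e \<in> cells"
  shows "\<bar>bump e y - bump e x - (\<Sum>l<d. bump_grad e x l * (y l - x l))\<bar> \<le> (\<Sum>l\<in>block (fst e). (x l - y l)\<^sup>2) / 8"
proof -
  let ?J = "block (fst e)"
  define a where "a = sqdist e x"
  define b where "b = sqdist e y"
  define D where "D = (\<Sum>l\<in>?J. (y l - x l)\<^sup>2)"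
  define I where "I = (\<Sum>l\<in>?J. (x l - center e l) * (y l - x l))"
  have b: "b = a + 2 * I + D"
    unfolding a_def b_def D_def I_def sqdist_def sum_distrib_left sum.distrib[symmetric]
    by (intro sum.cong) (auto simp: power2_eq_square algebra_simps)
  have CS: "I\<^sup>2 \<le> a * D"
    unfolding a_def D_def I_def sqdist_def by (rule Cauchy_Schwarz_ineq_sum)
  have "\<bar>(max 0 (r - b))\<^sup>2 - (max 0 (r - a))\<^sup>2 + 4 * max 0 (r - a) * I\<bar> \<le> 10 * r * D"
    by (rule clipped_square_remainder[OF _ _ _ _ CS b])
      (use r_pos sqdist_nonneg in \<open>auto simp: a_def b_def D_def sum_nonneg\<close>)
  then have "\<bar>(max 0 (r - b))\<^sup>2 - (max 0 (r - a))\<^sup>2 + 4 * max 0 (r - a) * I\<bar> / (80 * r) \<le> D / 8"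
    using r_pos by (simp add: field_simps)
  moreover have "(\<Sum>l<d. bump_grad e x l * (y l - x l)) = - max 0 (r - a) * I / (20 * r)"
  proof -
    have "(\<Sum>l<d. bump_grad e x l * (y l - x l)) = (\<Sum>l\<in>?J. bump_grad e x l * (y l - x l))"
      by (rule sum.mono_neutral_right) (use cells_block[OF assms] in \<open>auto simp: bump_grad_def\<close>)
    also have "\<dots> = (\<Sum>l\<in>?J. (- max 0 (r - a) / (20 * r)) * ((x l - center e l) * (y l - x l)))"
      by (intro sum.cong) (auto simp: bump_grad_def a_def)
    also have "\<dots> = (- max 0 (r - a) / (20 * r)) * I"
      unfolding I_def sum_distrib_left ..
    finally show ?thesis by simp
  qed
  moreover have "bump e y - bump e x - - max 0 (r - a) * I / (20 * r)
      = ((max 0 (r - b))\<^sup>2 - (max 0 (r - a))\<^sup>2 + 4 * max 0 (r - a) * I) / (80 * r)"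
    using r_pos by (simp add: bump_def a_def b_def field_simps)
  moreover have "D = (\<Sum>l\<in>?J. (x l - y l)\<^sup>2)"
    unfolding D_def by (intro sum.cong) (auto simp: power2_commute)
  ultimately show ?thesis using r_pos by (simp add: abs_divide)
qed

text \<open>Cells active at the same point belong to different, hence disjoint, blocks. This keeps
  the total curvature of the bumps independent of the dimension.\<close>

lemma sum_active_blocks_le:
  fixes g :: "nat \<Rightarrow> real"
  assumes "\<And>l. 0 \<le> g l" "b \<subseteq> active x"
  shows "(\<Sum>e\<in>b. \<Sum>l\<in>block (fst e). g l) \<le> (\<Sum>l<d. g l)"
proof -
  have "(\<Sum>e\<in>b. \<Sum>l\<in>block (fst e). g l) = (\<Sum>j\<in>fst ` b. \<Sum>l\<in>block j. g l)"
    using inj_on_subset[OF inj_on_active assms(2)] by (simp add: sum.reindex)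
  also have "\<dots> = (\<Sum>l\<in>(\<Union>j\<in>fst ` b. block j). g l)"
    using finite_subset[OF assms(2)] block_disjoint by (intro sum.UNION_disjoint[symmetric]) auto
  also have "\<dots> \<le> (\<Sum>l<d. g l)"
    using assms active_subset cells_block by (intro sum_mono2) blast+
  finally show ?thesis .
qed

text \<open>A bump has zero remainder unless it is active at \<open>x\<close> or at \<open>y\<close>, so each block
  contributes at most two of them.\<close>

lemma pot_remainder:
  assumes b: "b \<subseteq> cells"
  shows "\<bar>pot b y - pot b x - (\<Sum>l<d. pot_grad b x l * (y l - x l)) - (edist d x y)\<^sup>2 / 2\<bar> \<le> (edist d x y)\<^sup>2 / 4"
proof -
  have finb: "finite b" by (rule finite_subset[OF b finite_cells])
  define R where "R e = bump e y - bump e x - (\<Sum>l<d. bump_grad e x l * (y l - x l))" for e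
  define D where "D e = (\<Sum>l\<in>block (fst e). (x l - y l)\<^sup>2)" for e :: "nat \<times> (nat \<Rightarrow> nat)"
  have D0: "0 \<le> D e" for e unfolding D_def by (simp add: sum_nonneg)
  have R: "\<bar>R e\<bar> \<le> D e / 8" if "e \<in> b" for e
    unfolding R_def D_def using b that by (intro bump_remainder) auto
  have R0: "R e = 0" if "e \<in> b" "e \<notin> active x" "e \<notin> active y" for e
  proof -
    have "e \<in> cells" using b that(1) by blast
    then show ?thesis unfolding R_def using that by (simp add: bump_inactive bump_grad_inactive)
  qed
  have "(\<Sum>l<d. pot_grad b x l * (y l - x l))
      = (\<Sum>l<d. x l * (y l - x l)) + (\<Sum>l<d. \<Sum>e\<in>b. bump_grad e x l * (y l - x l))"
    unfolding sum.distrib[symmetric]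
    by (intro sum.cong) (auto simp: pot_grad_def algebra_simps sum_distrib_left sum_subtractf)
  also have "(\<Sum>l<d. \<Sum>e\<in>b. bump_grad e x l * (y l - x l)) = (\<Sum>e\<in>b. \<Sum>l<d. bump_grad e x l * (y l - x l))"
    by (rule sum.swap)
  finally have lin: "(\<Sum>l<d. pot_grad b x l * (y l - x l))
      = (\<Sum>l<d. x l * (y l - x l)) + (\<Sum>e\<in>b. \<Sum>l<d. bump_grad e x l * (y l - x l))" .
  have "(\<Sum>l<d. (y l)\<^sup>2) = (\<Sum>l<d. (x l)\<^sup>2) + 2 * (\<Sum>l<d. x l * (y l - x l)) + (edist d x y)\<^sup>2"
    unfolding edist_power2 sum_distrib_left sum.distrib[symmetric]
    by (intro sum.cong) (auto simp: power2_eq_square algebra_simps)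
  then have "pot b y - pot b x - (\<Sum>l<d. pot_grad b x l * (y l - x l)) - (edist d x y)\<^sup>2 / 2 = (\<Sum>e\<in>b. R e)"
    unfolding lin pot_def R_def sum_subtractf by (simp add: add_divide_distrib)
  also have "\<bar>\<Sum>e\<in>b. R e\<bar> \<le> (\<Sum>e\<in>b. \<bar>R e\<bar>)" by (rule sum_abs)
  also have "\<dots> \<le> (\<Sum>e\<in>b. (if e \<in> active x then D e / 8 else 0) + (if e \<in> active y then D e / 8 else 0))"
  proof (intro sum_mono)
    fix e assume "e \<in> b"
    then show "\<bar>R e\<bar> \<le> (if e \<in> active x then D e / 8 else 0) + (if e \<in> active y then D e / 8 else 0)"
      using R[of e] R0[of e] D0[of e] by auto
  qed
  also have "\<dots> = (\<Sum>e\<in>b \<inter> active x. D e) / 8 + (\<Sum>e\<in>b \<inter> active y. D e) / 8"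
    using finb by (simp add: sum.distrib sum.If_cases sum_divide_distrib Int_def)
  also have "\<dots> \<le> (edist d x y)\<^sup>2 / 8 + (edist d x y)\<^sup>2 / 8"
    unfolding D_def edist_power2
    by (intro add_mono divide_right_mono sum_active_blocks_le) auto
  finally show ?thesis by simp
qed

lemma pot_in_class: "b \<subseteq> cells \<Longrightarrow> pot b \<in> strongly_convex_smooth 0.5 1.5 d"
  and gradient_pot: "b \<subseteq> cells \<Longrightarrow> x \<in> euclid d \<Longrightarrow> gradient d (pot b) x = pot_grad b x"
proof -
  assume b: "b \<subseteq> cells"
  have g: "pot_grad b x \<in> euclid d" for x by (simp add: pot_grad_def euclid_def)
  \<comment> \<open>The quadratic term contributes exactly \<open>1 / 2\<close> and the bumps at
    most \<open>1 / 4\<close> in absolute value, which gives \<open>0.5 / 2\<close> and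
    \<open>1.5 / 2\<close>.\<close>
  have rem: "0.5 / 2 * (edist d x y)\<^sup>2 \<le> pot b y - pot b x - (\<Sum>i<d. pot_grad b x i * (y i - x i)) \<and>
      pot b y - pot b x - (\<Sum>i<d. pot_grad b x i * (y i - x i)) \<le> 1.5 / 2 * (edist d x y)\<^sup>2" for x y
    using abs_le_D1[OF pot_remainder[OF b, of y x]] abs_le_D2[OF pot_remainder[OF b, of y x]] by (intro conjI) linarith+
  show "pot b \<in> strongly_convex_smooth 0.5 1.5 d"
    by (rule strongly_convex_smoothI(1)[OF g rem])
  show "x \<in> euclid d \<Longrightarrow> gradient d (pot b) x = pot_grad b x"
    by (rule strongly_convex_smoothI(2)[OF g rem])
qed

lemma pot_local:
  assumes "b \<subseteq> cells" "b' \<subseteq> cells" "b \<inter> active x = b' \<inter> active x"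
  shows "pot b x = pot b' x" and "pot_grad b x = pot_grad b' x"
proof -
  have *: "(\<Sum>e\<in>b. g e) = (\<Sum>e\<in>b \<inter> active x. g e)" if "b \<subseteq> cells" "\<And>e. e \<in> cells \<Longrightarrow> e \<notin> active x \<Longrightarrow> g e = 0"
    for g :: "nat \<times> (nat \<Rightarrow> nat) \<Rightarrow> real" and b
    using that finite_subset[OF that(1)] by (intro sum.mono_neutral_right) auto
  show "pot b x = pot b' x"
    unfolding pot_def using *[OF assms(1), of "\<lambda>e. bump e x"] *[OF assms(2), of "\<lambda>e. bump e x"] assms(3) bump_inactive
    by simp
  have "(\<Sum>e\<in>b. bump_grad e x l) = (\<Sum>e\<in>b'. bump_grad e x l)" for l
    using *[OF assms(1), of "\<lambda>e. bump_grad e x l"] *[OF assms(2), of "\<lambda>e. bump_grad e x l"] assms(3) bump_grad_inactive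
    by simp
  then show "pot_grad b x = pot_grad b' x" unfolding pot_grad_def by simp
qed

end

subsection \<open>Normalizing constants\<close>

interpretation lborel_family: product_sigma_finite "\<lambda>_::nat. lborel :: real measure"
  by standard

lemma nn_integral_std_gaussian: "(\<integral>\<^sup>+t. ennreal (exp (- (t\<^sup>2) / 2)) \<partial>lborel) = ennreal (sqrt (2 * pi))"
proof -
  interpret prob_space "density lborel std_normal_density"
    by (rule prob_space_normal_density) simp
  have "(\<integral>\<^sup>+t. ennreal (std_normal_density t) \<partial>lborel) = 1"
    using emeasure_space_1 by (simp add: emeasure_density)
  moreover have "(\<integral>\<^sup>+t. ennreal (exp (- (t\<^sup>2) / 2)) \<partial>lborel)
      = (\<integral>\<^sup>+t. ennreal (sqrt (2 * pi)) * ennreal (std_normal_density t) \<partial>lborel)"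
    by (intro nn_integral_cong) (simp add: std_normal_density_def ennreal_mult'[symmetric])
  ultimately show ?thesis by (simp add: nn_integral_cmult)
qed

lemma nn_integral_gaussian_PiM:
  fixes J :: "nat set"
  assumes "finite J"
  shows "(\<integral>\<^sup>+x. ennreal (exp (- (\<Sum>l\<in>J. (x l)\<^sup>2) / 2)) \<partial>(PiM J (\<lambda>_. lborel))) = ennreal (sqrt (2 * pi) ^ card J)"
proof -
  have "(\<integral>\<^sup>+x. ennreal (exp (- (\<Sum>l\<in>J. (x l)\<^sup>2) / 2)) \<partial>(PiM J (\<lambda>_. lborel)))
      = (\<integral>\<^sup>+x. (\<Prod>l\<in>J. ennreal (exp (- ((x l)\<^sup>2) / 2))) \<partial>(PiM J (\<lambda>_. lborel)))"
    using assms by (intro nn_integral_cong)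
      (simp add: prod_ennreal exp_sum[symmetric] sum_divide_distrib sum_negf)
  also have "\<dots> = (\<Prod>l\<in>J. \<integral>\<^sup>+t. ennreal (exp (- (t\<^sup>2) / 2)) \<partial>lborel)"
    using assms by (intro lborel_family.product_nn_integral_prod) auto
  also have "\<dots> = ennreal (sqrt (2 * pi) ^ card J)"
    unfolding nn_integral_std_gaussian by (simp add: ennreal_power)
  finally show ?thesis .
qed

context bump_grid
begin

section \<open>Measurability and the mass removed by one bump\<close>

lemma bump_measurable:
  assumes "block (fst e) \<subseteq> J"
  shows "bump e \<in> borel_measurable (PiM J (\<lambda>_. lborel))"
proof -
  have [measurable]: "(\<lambda>x. x l) \<in> borel_measurable (PiM J (\<lambda>_. lborel))" if "l \<in> block (fst e)" for l
    using measurable_component_singleton[of l J "\<lambda>_. lborel"] that assms by auto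
  show ?thesis unfolding bump_def[abs_def] sqdist_def by measurable
qed

lemma square_sum_measurable:
  "(\<lambda>x. \<Sum>l\<in>J. (x l)\<^sup>2) \<in> borel_measurable (PiM J (\<lambda>_::nat. lborel :: real measure))"
proof -
  have [measurable]: "(\<lambda>x. x l) \<in> borel_measurable (PiM J (\<lambda>_. lborel :: real measure))" if "l \<in> J" for l
    using measurable_component_singleton[of l J "\<lambda>_. lborel"] that by auto
  show ?thesis by measurable
qed

lemma pot_measurable [measurable]:
  assumes "b \<subseteq> cells"
  shows "pot b \<in> borel_measurable (PiM {..<d} (\<lambda>_. lborel))"
  unfolding pot_def[abs_def]
  using assms cells_block square_sum_measurable[of "{..<d}"]
  by (intro borel_measurable_add borel_measurable_divide borel_measurable_sum bump_measurable) auto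

lemma bump_cong: "(\<And>l. l \<in> block (fst e) \<Longrightarrow> x l = y l) \<Longrightarrow> bump e x = bump e y"
  by (simp add: bump_def sqdist_def cong: sum.cong)

text \<open>The three factors bound from below the Gaussian weight on the unit cube of a block, the
  value of \<open>1 - exp (- bump e y)\<close> near the center, and the volume of the small
  cube.\<close>

definition box_mass :: real where
  "box_mass = exp (- (real k / 2)) * (r / 320) * (1 / (2 * real k * real p)) ^ k"

text \<open>The mass which the bump \<open>e\<close> removes is bounded below on the cube of side
  \<open>1 / (2 k p)\<close> around its center, where no other bump of the same block is active.\<close>

lemma block_integral_lower:
  assumes b: "b \<subseteq> cells" and e: "e \<in> cells - b"
  defines "J \<equiv> block (fst e)"
  shows "ennreal box_mass \<le> (\<integral>\<^sup>+y. ennreal (exp (- ((\<Sum>l\<in>J. (y l)\<^sup>2) / 2 + (\<Sum>e'\<in>{e'\<in>b. fst e' = fst e}. bump e' y)))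
      * (1 - exp (- bump e y))) \<partial>(PiM J (\<lambda>_. lborel)))"
proof -
  \<comment> \<open>Half the side of the small cube: its points satisfy
    \<open>sqdist e y <= k * a^2 <= r / 4\<close>, well inside the support of the bump.\<close>
  define a where "a = 1 / (4 * real k * real p)"
  define B where "B = (\<Pi>\<^sub>E l\<in>J. {center e l - a..center e l + a})"
  have a0: "0 < a" using k p by (simp add: a_def)
  have eB: "emeasure (PiM J (\<lambda>_. lborel)) B = ennreal ((1 / (2 * real k * real p)) ^ k)"
  proof -
    have "emeasure (PiM J (\<lambda>_. lborel)) B = (\<Prod>l\<in>J. emeasure lborel {center e l - a..center e l + a})"
      unfolding B_def J_def by (intro lborel_family.emeasure_PiM) auto
    also have "\<dots> = ennreal ((2 * a) ^ k)" using a0 by (simp add: J_def ennreal_power)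
    also have "2 * a = 1 / (2 * real k * real p)" by (simp add: a_def)
    finally show ?thesis .
  qed
  have Bsets: "B \<in> sets (PiM J (\<lambda>_. lborel))"
    unfolding B_def J_def by (intro sets_PiM_I_finite) auto
  have lower: "exp (- (real k / 2)) * (r / 320) \<le> exp (- ((\<Sum>l\<in>J. (y l)\<^sup>2) / 2 + (\<Sum>e'\<in>{e'\<in>b. fst e' = fst e}. bump e' y)))
      * (1 - exp (- bump e y))" if y: "y \<in> B" for y
  proof -
    have near: "\<bar>y l - center e l\<bar> \<le> a" if "l \<in> J" for l
    proof -
      have "center e l - a \<le> y l" "y l \<le> center e l + a" using y that by (auto simp: B_def PiE_def Pi_def)
      then show ?thesis by linarith
    qed
    have "sqdist e y \<le> (\<Sum>l\<in>J. a\<^sup>2)"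
      unfolding sqdist_def J_def[symmetric] using near a0
      by (intro sum_mono) (metis abs_ge_zero power2_abs power_mono)
    also have "\<dots> = real k * a\<^sup>2" by (simp add: J_def)
    also have "\<dots> \<le> r / 4"
    proof -
      have "real k * a\<^sup>2 = (1 / real k) * (1 / (16 * (real p)\<^sup>2))"
        using k by (simp add: a_def power_divide power_mult_distrib power2_eq_square)
      also have "\<dots> \<le> 1 * (1 / (16 * (real p)\<^sup>2))"
        using k by (intro mult_right_mono) auto
      finally show ?thesis by (simp add: r_def)
    qed
    finally have sq: "sqdist e y \<le> r / 4" .
    have act: "e \<in> active y" using sq e r_pos by (auto simp: active_def)
    have zero: "(\<Sum>e'\<in>{e'\<in>b. fst e' = fst e}. bump e' y) = 0"
    proof (intro sum.neutral ballI)
      fix e' assume "e' \<in> {e' \<in> b. fst e' = fst e}"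
      then have "e' \<in> cells" "e' \<noteq> e" "fst e' = fst e" using b e by auto
      then show "bump e' y = 0" using bump_inactive active_eq[OF _ act] by blast
    qed
    have "y l \<in> {0..1}" if l: "l \<in> J" for l
    proof -
      have "snd e l < p" using e l by (auto simp: cells_def J_def)
      then have "real (snd e l) + 1 \<le> real p" by linarith
      then have "center e l \<le> (real p - 1 / 2) / real p" "1 / 2 / real p \<le> center e l"
        unfolding center_def by (intro divide_right_mono; simp)+
      moreover have "(real p - 1 / 2) / real p = 1 - 1 / 2 / real p" using p by (simp add: diff_divide_distrib)
      moreover have "a \<le> 1 / 2 / real p" using k p by (simp add: a_def field_simps)
      ultimately show ?thesis using near[OF l] by (auto simp: abs_le_iff)
    qed
    then have "(y l)\<^sup>2 \<le> 1" if "l \<in> J" for l using that by (simp add: power_le_one)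
    then have "(\<Sum>l\<in>J. (y l)\<^sup>2) \<le> (\<Sum>l\<in>J. 1)" by (intro sum_mono)
    then have G: "exp (- (real k / 2)) \<le> exp (- ((\<Sum>l\<in>J. (y l)\<^sup>2) / 2 + (\<Sum>e'\<in>{e'\<in>b. fst e' = fst e}. bump e' y)))"
      unfolding zero by (simp add: J_def)
    \<comment> \<open>At squared distance at most \<open>r / 4\<close> the bump is at least
      \<open>9 * r / 1280\<close>, which exceeds \<open>r / 160\<close>.\<close>
    have bl: "r / 160 \<le> bump e y"
    proof -
      have "3 * r / 4 \<le> max 0 (r - sqdist e y)" using sq by linarith
      then have "(3 * r / 4)\<^sup>2 \<le> (max 0 (r - sqdist e y))\<^sup>2" by (rule power_mono) (use r_pos in simp)
      then have "(3 * r / 4)\<^sup>2 / (80 * r) \<le> bump e y"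
        unfolding bump_def by (rule divide_right_mono) (use r_pos in simp)
      moreover have "r / 160 \<le> (3 * r / 4)\<^sup>2 / (80 * r)" using r_pos by (simp add: power2_eq_square field_simps)
      ultimately show ?thesis by linarith
    qed
    \<comment> \<open>From \<open>exp (- t) <= 1 / (1 + t) <= 1 - t / 2\<close> for \<open>t\<close>
      between 0 and 1.\<close>
    have "r / 320 \<le> 1 - exp (- bump e y)"
    proof -
      define t where "t = bump e y"
      have t: "0 \<le> t" "t \<le> 1" using bump_nonneg bump_le[of e y] r_le by (auto simp: t_def)
      have "(1 + t) * (1 - t / 2) \<ge> 1" using t mult_left_mono[of t 1 t] by (simp add: algebra_simps)
      then have "1 / (1 + t) \<le> 1 - t / 2" using t by (simp add: divide_le_eq mult.commute)
      moreover have "exp (- t) \<le> 1 / (1 + t)"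
        using exp_ge_add_one_self[of t] t by (simp add: exp_minus divide_simps)
      ultimately have "t / 2 \<le> 1 - exp (- t)" by linarith
      then show ?thesis using bl by (simp add: t_def)
    qed
    then show ?thesis using G r_pos by (intro mult_mono) auto
  qed
  have "ennreal box_mass = ennreal (exp (- (real k / 2)) * (r / 320)) * emeasure (PiM J (\<lambda>_. lborel)) B"
    unfolding eB box_mass_def using r_pos by (simp add: ennreal_mult'[symmetric])
  also have "\<dots> = (\<integral>\<^sup>+y. ennreal (exp (- (real k / 2)) * (r / 320)) * indicator B y \<partial>(PiM J (\<lambda>_. lborel)))"
    using Bsets by (simp add: nn_integral_cmult_indicator)
  also have "\<dots> \<le> (\<integral>\<^sup>+y. ennreal (exp (- ((\<Sum>l\<in>J. (y l)\<^sup>2) / 2 + (\<Sum>e'\<in>{e'\<in>b. fst e' = fst e}. bump e' y)))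
      * (1 - exp (- bump e y))) \<partial>(PiM J (\<lambda>_. lborel)))"
    using lower by (intro nn_integral_mono) (auto simp: indicator_def intro!: ennreal_leI)
  finally show ?thesis .
qed

text \<open>By Fubini the integrand splits into a factor for the block of \<open>e\<close> and a
  factor for all other coordinates. The latter integrates to the same \<open>c\<close> on both
  sides, so the relative loss depends on \<open>k\<close> and \<open>p\<close> but not on
  \<open>d\<close>.\<close>

lemma bump_mass_lower:
  assumes b: "b \<subseteq> cells" and e: "e \<in> cells - b"
  shows "ennreal box_mass * (\<integral>\<^sup>+x. ennreal (exp (- pot b x)) \<partial>(PiM {..<d} (\<lambda>_. lborel)))
    \<le> ennreal (sqrt (2 * pi) ^ k) * (\<integral>\<^sup>+x. ennreal (exp (- pot b x) * (1 - exp (- bump e x))) \<partial>(PiM {..<d} (\<lambda>_. lborel)))"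
proof -
  define J where "J = block (fst e)"
  define I where "I = {..<d} - J"
  define E where "E x = exp (- ((\<Sum>l\<in>I. (x l)\<^sup>2) / 2 + (\<Sum>e'\<in>{e'\<in>b. fst e' \<noteq> fst e}. bump e' x)))" for x
  define G where "G y = exp (- ((\<Sum>l\<in>J. (y l)\<^sup>2) / 2 + (\<Sum>e'\<in>{e'\<in>b. fst e' = fst e}. bump e' y)))" for y
  have J: "J \<subseteq> {..<d}" using e cells_block by (auto simp: J_def)
  have IJ: "I \<inter> J = {}" "finite I" "finite J" "I \<union> J = {..<d}" using J by (auto simp: I_def J_def)
  have finb: "finite b" by (rule finite_subset[OF b finite_cells])
  have bI: "block (fst e') \<subseteq> I" if "e' \<in> b" "fst e' \<noteq> fst e" for e'
    using that b cells_block[of e'] block_disjoint[of "fst e'" "fst e"] by (auto simp: I_def J_def)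
  have split: "exp (- pot b (merge I J (x, y))) = E x * G y" for x y
  proof -
    let ?z = "merge I J (x, y)"
    have "(\<Sum>l<d. (?z l)\<^sup>2) = (\<Sum>l\<in>I. (x l)\<^sup>2) + (\<Sum>l\<in>J. (y l)\<^sup>2)"
    proof -
      have "(\<Sum>l<d. (?z l)\<^sup>2) = (\<Sum>l\<in>I. (?z l)\<^sup>2) + (\<Sum>l\<in>J. (?z l)\<^sup>2)"
        using sum.union_disjoint[OF IJ(2,3,1), of "\<lambda>l. (?z l)\<^sup>2"] unfolding IJ(4) .
      also have "(\<Sum>l\<in>I. (?z l)\<^sup>2) = (\<Sum>l\<in>I. (x l)\<^sup>2)"
        by (intro sum.cong) (auto simp: merge_def)
      also have "(\<Sum>l\<in>J. (?z l)\<^sup>2) = (\<Sum>l\<in>J. (y l)\<^sup>2)"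
        using IJ(1) by (intro sum.cong) (auto simp: merge_def)
      finally show ?thesis .
    qed
    moreover have "(\<Sum>e'\<in>b. bump e' ?z) = (\<Sum>e'\<in>{e'\<in>b. fst e' \<noteq> fst e}. bump e' x) + (\<Sum>e'\<in>{e'\<in>b. fst e' = fst e}. bump e' y)"
    proof -
      have "(\<Sum>e'\<in>b. bump e' ?z) = (\<Sum>e'\<in>{e'\<in>b. fst e' \<noteq> fst e} \<union> {e'\<in>b. fst e' = fst e}. bump e' ?z)"
        by (intro sum.cong) auto
      also have "\<dots> = (\<Sum>e'\<in>{e'\<in>b. fst e' \<noteq> fst e}. bump e' ?z) + (\<Sum>e'\<in>{e'\<in>b. fst e' = fst e}. bump e' ?z)"
        using finb by (intro sum.union_disjoint) auto
      also have "(\<Sum>e'\<in>{e'\<in>b. fst e' \<noteq> fst e}. bump e' ?z) = (\<Sum>e'\<in>{e'\<in>b. fst e' \<noteq> fst e}. bump e' x)"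
        using bI by (intro sum.cong bump_cong) (auto simp: merge_def)
      also have "(\<Sum>e'\<in>{e'\<in>b. fst e' = fst e}. bump e' ?z) = (\<Sum>e'\<in>{e'\<in>b. fst e' = fst e}. bump e' y)"
        using IJ(1) by (intro sum.cong bump_cong) (auto simp: merge_def J_def)
      finally show ?thesis .
    qed
    ultimately show ?thesis unfolding pot_def E_def G_def by (simp add: exp_add[symmetric] add_divide_distrib algebra_simps)
  qed
  have bump_merge: "bump e (merge I J (x, y)) = bump e y" for x y
    using IJ(1) by (intro bump_cong) (auto simp: merge_def J_def)
  have E_meas [measurable]: "E \<in> borel_measurable (PiM I (\<lambda>_. lborel))"
    unfolding E_def[abs_def] using bI square_sum_measurable[of I]
    by (intro borel_measurable_exp measurable_compose[OF _ borel_measurable_exp] borel_measurable_uminus borel_measurable_add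
        borel_measurable_divide borel_measurable_sum bump_measurable) auto
  have G_meas [measurable]: "G \<in> borel_measurable (PiM J (\<lambda>_. lborel))"
    unfolding G_def[abs_def] using square_sum_measurable[of J]
    by (intro measurable_compose[OF _ borel_measurable_exp] borel_measurable_uminus borel_measurable_add
        borel_measurable_divide borel_measurable_sum bump_measurable) (auto simp: J_def)
  have [measurable]: "bump e \<in> borel_measurable (PiM J (\<lambda>_. lborel))"
    "bump e \<in> borel_measurable (PiM {..<d} (\<lambda>_. lborel))"
    using J by (auto intro: bump_measurable simp: J_def)
  note [measurable] = pot_measurable[OF b]
  have E0: "0 \<le> E x" and G0: "0 \<le> G x" for x by (simp_all add: E_def G_def)
  define c where "c = (\<integral>\<^sup>+x. ennreal (E x) \<partial>(PiM I (\<lambda>_. lborel)))"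
  have prod: "(\<integral>\<^sup>+x. f x \<partial>(PiM {..<d} (\<lambda>_. lborel))) = c * (\<integral>\<^sup>+y. g y \<partial>(PiM J (\<lambda>_. lborel)))"
    if "f \<in> borel_measurable (PiM {..<d} (\<lambda>_. lborel))" "g \<in> borel_measurable (PiM J (\<lambda>_. lborel))"
      "\<And>x y. f (merge I J (x, y)) = ennreal (E x) * g y" for f g
  proof -
    have "(\<integral>\<^sup>+x. f x \<partial>(PiM {..<d} (\<lambda>_. lborel))) = (\<integral>\<^sup>+x. (\<integral>\<^sup>+y. f (merge I J (x, y)) \<partial>(PiM J (\<lambda>_. lborel))) \<partial>(PiM I (\<lambda>_. lborel)))"
      using lborel_family.product_nn_integral_fold[OF IJ(1-3), of f] that(1) unfolding IJ(4) by simp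
    also have "\<dots> = (\<integral>\<^sup>+x. ennreal (E x) * (\<integral>\<^sup>+y. g y \<partial>(PiM J (\<lambda>_. lborel))) \<partial>(PiM I (\<lambda>_. lborel)))"
      using that(2) by (intro nn_integral_cong) (simp add: that(3) nn_integral_cmult)
    also have "\<dots> = c * (\<integral>\<^sup>+y. g y \<partial>(PiM J (\<lambda>_. lborel)))"
      unfolding c_def by (rule nn_integral_multc) measurable
    finally show ?thesis .
  qed
  have "(\<integral>\<^sup>+x. ennreal (exp (- pot b x)) \<partial>(PiM {..<d} (\<lambda>_. lborel))) = c * (\<integral>\<^sup>+y. ennreal (G y) \<partial>(PiM J (\<lambda>_. lborel)))"
    using E0 G0 by (intro prod) (auto simp: split ennreal_mult)
  also have "(\<integral>\<^sup>+y. ennreal (G y) \<partial>(PiM J (\<lambda>_. lborel))) \<le> (\<integral>\<^sup>+y. ennreal (exp (- (\<Sum>l\<in>J. (y l)\<^sup>2) / 2)) \<partial>(PiM J (\<lambda>_. lborel)))"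
    unfolding G_def by (intro nn_integral_mono ennreal_leI) (auto intro!: sum_nonneg bump_nonneg)
  also have "\<dots> = ennreal (sqrt (2 * pi) ^ k)"
    using nn_integral_gaussian_PiM[OF IJ(3)] by (simp add: J_def)
  finally have upper: "(\<integral>\<^sup>+x. ennreal (exp (- pot b x)) \<partial>(PiM {..<d} (\<lambda>_. lborel))) \<le> c * ennreal (sqrt (2 * pi) ^ k)"
    by (simp add: mult_left_mono)
  have "c * ennreal box_mass \<le> c * (\<integral>\<^sup>+y. ennreal (G y * (1 - exp (- bump e y))) \<partial>(PiM J (\<lambda>_. lborel)))"
    using block_integral_lower[OF b e] unfolding G_def J_def by (intro mult_left_mono) auto
  also have "\<dots> = (\<integral>\<^sup>+x. ennreal (exp (- pot b x) * (1 - exp (- bump e x))) \<partial>(PiM {..<d} (\<lambda>_. lborel)))"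
    using E0 G0 bump_nonneg by (intro prod[symmetric]) (auto simp: split bump_merge ennreal_mult[symmetric] mult.assoc)
  finally have lower: "c * ennreal box_mass \<le> (\<integral>\<^sup>+x. ennreal (exp (- pot b x) * (1 - exp (- bump e x))) \<partial>(PiM {..<d} (\<lambda>_. lborel)))" .
  show ?thesis
    using mult_left_mono[OF upper, of "ennreal box_mass"] mult_left_mono[OF lower, of "ennreal (sqrt (2 * pi) ^ k)"]
    by (auto simp: mult_ac elim: order_trans)
qed

end

section \<open>Decrease of the normalizing constant under one more bump\<close>

context bump_grid
begin

abbreviation "lebesgue_d \<equiv> PiM {..<d} (\<lambda>_. lborel :: real measure)"

text \<open>Each bump lies between 0 and 1, so the integral is squeezed between the Gaussian one and
  \<open>exp (- card b)\<close> times it. Positivity permits taking logarithms later.\<close>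

lemma nn_integral_pot:
  assumes b: "b \<subseteq> cells"
  shows "(\<integral>\<^sup>+x. ennreal (exp (- pot b x)) \<partial>lebesgue_d) = ennreal (normalizing_constant d (pot b))"
    and "0 < normalizing_constant d (pot b)"
proof -
  note [measurable] = pot_measurable[OF b]
  let ?N = "\<integral>\<^sup>+x. ennreal (exp (- pot b x)) \<partial>lebesgue_d"
  let ?g = "\<integral>\<^sup>+x. ennreal (exp (- (\<Sum>l<d. (x l)\<^sup>2) / 2)) \<partial>lebesgue_d"
  have g: "?g = ennreal (sqrt (2 * pi) ^ d)" using nn_integral_gaussian_PiM[of "{..<d}"] by simp
  have "?N \<le> ?g"
    unfolding pot_def by (intro nn_integral_mono ennreal_leI) (auto intro!: sum_nonneg bump_nonneg)
  then have fin: "?N < \<top>" unfolding g by (rule le_less_trans) simp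
  have meas: "(\<lambda>x. ennreal (exp (- (\<Sum>l<d. (x l)\<^sup>2) / 2))) \<in> borel_measurable lebesgue_d"
    by (intro measurable_compose[OF _ measurable_ennreal] measurable_compose[OF _ borel_measurable_exp] borel_measurable_divide
        borel_measurable_uminus square_sum_measurable) auto
  have "ennreal (exp (- real (card b))) * ?g = (\<integral>\<^sup>+x. ennreal (exp (- real (card b))) * ennreal (exp (- (\<Sum>l<d. (x l)\<^sup>2) / 2)) \<partial>lebesgue_d)"
    by (rule nn_integral_cmult[OF meas, symmetric])
  also have "\<dots> \<le> ?N"
  proof (rule nn_integral_mono)
    fix x :: point
    have "(\<Sum>e\<in>b. bump e x) \<le> (\<Sum>e\<in>b. 1)"
      using bump_le r_le r_pos by (intro sum_mono) (smt (verit) divide_le_eq_1_pos)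
    then have "exp (- real (card b) - (\<Sum>l<d. (x l)\<^sup>2) / 2) \<le> exp (- pot b x)" by (simp add: pot_def)
    then show "ennreal (exp (- real (card b))) * ennreal (exp (- (\<Sum>l<d. (x l)\<^sup>2) / 2)) \<le> ennreal (exp (- pot b x))"
      by (simp add: ennreal_mult[symmetric] exp_add[symmetric] ennreal_leI)
  qed
  finally have "ennreal (exp (- real (card b))) * ennreal (sqrt (2 * pi) ^ d) \<le> ?N" unfolding g .
  then have "ennreal (exp (- real (card b)) * sqrt (2 * pi) ^ d) \<le> ?N" by (simp add: ennreal_mult)
  moreover have "0 < exp (- real (card b)) * sqrt (2 * pi) ^ d" by simp
  ultimately have pos: "0 < ?N" by (metis ennreal_less_zero_iff less_le_trans)
  have Z: "normalizing_constant d (pot b) = enn2real ?N"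
    unfolding normalizing_constant_def by (rule integral_eq_nn_integral) auto
  show "?N = ennreal (normalizing_constant d (pot b))" using fin by (simp add: Z)
  show "0 < normalizing_constant d (pot b)" using fin pos by (simp add: Z enn2real_positive_iff)
qed

definition gap :: real where
  "gap = box_mass / sqrt (2 * pi) ^ k"

lemma gap_pos: "0 < gap"
  using k p r_pos by (simp add: gap_def box_mass_def)

lemma normalizing_constant_insert:
  assumes b: "b \<subseteq> cells" and e: "e \<in> cells - b"
  shows "normalizing_constant d (pot (insert e b)) \<le> (1 - gap) * normalizing_constant d (pot b)"
proof -
  have eb: "insert e b \<subseteq> cells" using b e by auto
  have finb: "finite b" by (rule finite_subset[OF b finite_cells])
  note [measurable] = pot_measurable[OF b] pot_measurable[OF eb]
  have [measurable]: "bump e \<in> borel_measurable lebesgue_d" using e cells_block by (intro bump_measurable) auto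
  let ?Z = "\<lambda>b. normalizing_constant d (pot b)"
  let ?W = "\<integral>\<^sup>+x. ennreal (exp (- pot b x) * (1 - exp (- bump e x))) \<partial>lebesgue_d"
  have pot_insert: "pot (insert e b) x = pot b x + bump e x" for x
    using e finb by (simp add: pot_def)
  have "ennreal (?Z b) = (\<integral>\<^sup>+x. ennreal (exp (- pot b x) * (1 - exp (- bump e x))) + ennreal (exp (- pot (insert e b) x)) \<partial>lebesgue_d)"
    unfolding nn_integral_pot(1)[OF b, symmetric] using bump_nonneg
    by (intro nn_integral_cong) (simp add: pot_insert ennreal_plus[symmetric] exp_add[symmetric] algebra_simps del: ennreal_plus)
  also have "\<dots> = ?W + ennreal (?Z (insert e b))"
    unfolding nn_integral_pot(1)[OF eb, symmetric] by (rule nn_integral_add) auto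
  finally have sum: "ennreal (?Z b) = ?W + ennreal (?Z (insert e b))" .
  have "?W \<le> ennreal (?Z b)" unfolding sum by simp
  then have "?W < \<top>" by (rule le_less_trans) simp
  then obtain w where w: "0 \<le> w" "?W = ennreal w" by (cases ?W) auto
  have zs: "0 < ?Z b" "0 < ?Z (insert e b)" using nn_integral_pot(2) b eb by auto
  then have z: "?Z b = w + ?Z (insert e b)" using sum w by (simp add: ennreal_plus[symmetric] del: ennreal_plus)
  have box: "0 < box_mass" using k p r_pos by (simp add: box_mass_def)
  have "ennreal (box_mass * ?Z b) \<le> ennreal (sqrt (2 * pi) ^ k * w)"
    using bump_mass_lower[OF b e] w zs box unfolding nn_integral_pot(1)[OF b] by (simp add: ennreal_mult)
  then have "box_mass * ?Z b \<le> sqrt (2 * pi) ^ k * w" using w by (simp add: ennreal_le_iff)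
  then have "gap * ?Z b \<le> w" by (simp add: gap_def field_simps)
  then show ?thesis using z by (simp add: algebra_simps)
qed

text \<open>The logarithm turns the relative decrease into an additive one by
  \<open>ln t <= t - 1\<close>; this is the step hypothesis of
  \<open>interval_count\<close>.\<close>

lemma ln_normalizing_constant_insert:
  assumes b: "b \<subseteq> cells" and e: "e \<in> cells - b"
  shows "- ln (normalizing_constant d (pot b)) + gap \<le> - ln (normalizing_constant d (pot (insert e b)))"
proof -
  let ?Z = "\<lambda>b. normalizing_constant d (pot b)"
  have eb: "insert e b \<subseteq> cells" using b e by auto
  have zs: "0 < ?Z b" "0 < ?Z (insert e b)" using nn_integral_pot(2) b eb by auto
  have "?Z (insert e b) / ?Z b \<le> 1 - gap"
    using normalizing_constant_insert[OF b e] zs by (simp add: divide_le_eq)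
  moreover have "ln (?Z (insert e b) / ?Z b) \<le> ?Z (insert e b) / ?Z b - 1"
    using zs by (intro ln_le_minus_one) simp
  ultimately show ?thesis using zs by (simp add: ln_div)
qed

section \<open>Counting the hidden sets that fit a given output\<close>

definition accurate :: "real \<Rightarrow> (nat \<times> (nat \<Rightarrow> nat)) set \<Rightarrow> real \<Rightarrow> bool" where
  "accurate \<epsilon> b z \<longleftrightarrow> (1 - \<epsilon>) * normalizing_constant d (pot b) \<le> z \<and> z \<le> (1 + \<epsilon>) * normalizing_constant d (pot b)"

lemma accurate_count:
  assumes R: "R \<subseteq> cells" "c \<subseteq> R" "card R \<le> n * m" "2 * n \<le> p ^ k"
    and \<epsilon>: "0 < \<epsilon>" "\<epsilon> \<le> 1 / 2" and scale: "4 * \<epsilon> / gap + 1 \<le> 3 / 4 * sqrt (real (m * p ^ k) / 2)"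
  shows "real (card {S. S \<subseteq> cells - R \<and> accurate \<epsilon> (c \<union> S) z}) \<le> 3 / 4 * 2 ^ card (cells - R)"
proof (cases "0 < z")
  case False
  have "\<not> accurate \<epsilon> (c \<union> S) z" if "S \<subseteq> cells - R" for S
  proof -
    have "0 < normalizing_constant d (pot (c \<union> S))" using that R by (intro nn_integral_pot(2)) auto
    then have "0 < (1 - \<epsilon>) * normalizing_constant d (pot (c \<union> S))" using \<epsilon> by simp
    then show ?thesis using False by (auto simp: accurate_def)
  qed
  then have empty: "{S. S \<subseteq> cells - R \<and> accurate \<epsilon> (c \<union> S) z} = {}" by auto
  show ?thesis unfolding empty by simp
next
  case z: True
  define F where "F S = - ln (normalizing_constant d (pot (c \<union> S)))" for S
  define u where "u = ln (1 - \<epsilon>) - ln z"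
  define v where "v = ln (1 + \<epsilon>) - ln z"
  have "ln (1 + \<epsilon>) \<le> \<epsilon>" using \<epsilon> by (simp add: ln_add_one_self_le_self)
  moreover have "0 \<le> ln (1 + \<epsilon>)" "ln (1 - \<epsilon>) \<le> 0" using \<epsilon> by auto
  moreover have "- \<epsilon> - 2 * \<epsilon>\<^sup>2 \<le> ln (1 - \<epsilon>)" using \<epsilon> by (intro ln_one_minus_pos_lower_bound) auto
  moreover have "\<epsilon>\<^sup>2 \<le> \<epsilon> * (1 / 2)" unfolding power2_eq_square using \<epsilon> by (intro mult_left_mono) auto
  \<comment> \<open>The upper end contributes at most \<open>\<epsilon>\<close> and the lower end at
    most \<open>\<epsilon> + 2 * \<epsilon>^2 <= 2 * \<epsilon>\<close>.\<close>
  ultimately have uv: "v - u \<le> 4 * \<epsilon>" "u \<le> v" unfolding u_def v_def using \<epsilon> by linarith+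
  have "{S. S \<subseteq> cells - R \<and> accurate \<epsilon> (c \<union> S) z} \<subseteq> {S. S \<subseteq> cells - R \<and> u \<le> F S \<and> F S \<le> v}"
  proof safe
    fix S assume S: "S \<subseteq> cells - R" and acc: "accurate \<epsilon> (c \<union> S) z"
    let ?Z = "normalizing_constant d (pot (c \<union> S))"
    have Z: "0 < ?Z" using S R by (intro nn_integral_pot(2)) auto
    have "ln ((1 - \<epsilon>) * ?Z) \<le> ln z" "ln z \<le> ln ((1 + \<epsilon>) * ?Z)"
      using acc Z z \<epsilon> by (auto simp: accurate_def)
    moreover have "ln ((1 - \<epsilon>) * ?Z) = ln (1 - \<epsilon>) + ln ?Z" "ln ((1 + \<epsilon>) * ?Z) = ln (1 + \<epsilon>) + ln ?Z"
      using Z \<epsilon> by (auto intro: ln_mult_pos)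
    ultimately show "u \<le> F S" "F S \<le> v" by (auto simp: u_def v_def F_def)
  qed
  then have "real (card {S. S \<subseteq> cells - R \<and> accurate \<epsilon> (c \<union> S) z}) \<le> real (card {S. S \<subseteq> cells - R \<and> u \<le> F S \<and> F S \<le> v})"
    by (intro of_nat_mono card_mono) auto
  also have "\<dots> \<le> ((v - u) / gap + 1) / sqrt (real (card (cells - R) + 1)) * 2 ^ card (cells - R)"
  proof (rule interval_count)
    show "u \<le> v + gap" using uv gap_pos by linarith
    fix S e assume "S \<subseteq> cells - R" "e \<in> cells - R - S"
    then show "F S + gap \<le> F (insert e S)"
      unfolding F_def using R ln_normalizing_constant_insert[of "c \<union> S" e] by auto
  qed (use gap_pos in auto)
  also have "\<dots> \<le> 3 / 4 * 2 ^ card (cells - R)"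
  proof (rule mult_right_mono)
    \<comment> \<open>The queries reveal at most \<open>n * m\<close> of the \<open>m * p^k\<close>
      cells, so at least half of the cells remain free.\<close>
    have "2 * (n * m) \<le> m * p ^ k" using mult_right_mono[OF R(4), of m] by (simp add: mult_ac)
    moreover have "card (cells - R) = m * p ^ k - card R"
      using R(1) finite_subset[OF R(1)] by (simp add: card_Diff_subset card_cells)
    ultimately have "m * p ^ k \<le> 2 * card (cells - R)" using R(3) by linarith
    then have "real (m * p ^ k) \<le> 2 * real (card (cells - R))" by (metis of_nat_le_iff of_nat_mult of_nat_numeral)
    then have "sqrt (real (m * p ^ k) / 2) \<le> sqrt (real (card (cells - R) + 1))"
      by (intro real_sqrt_le_mono) simp
    moreover have "(v - u) / gap \<le> 4 * \<epsilon> / gap" using uv gap_pos by (intro divide_right_mono) auto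
    ultimately have "(v - u) / gap + 1 \<le> 3 / 4 * sqrt (real (card (cells - R) + 1))" using scale by linarith
    then show "((v - u) / gap + 1) / sqrt (real (card (cells - R) + 1)) \<le> 3 / 4"
      by (simp add: divide_le_eq)
  qed simp
  finally show ?thesis .
qed

text \<open>The hidden set is averaged uniformly over all subsets of \<open>cells\<close>; the
  decision tree bound holds for each strategy in the support space, so one potential of the class
  defeats the randomized procedure.\<close>

lemma not_estimates_Z:
  assumes P: "randomized_algorithm d P" and q: "max_queries (strongly_convex_smooth 0.5 1.5 d) d P \<le> enat n"
    and n: "2 * n \<le> p ^ k" and \<epsilon>: "0 < \<epsilon>" "\<epsilon> \<le> 1 / 2"
    and scale: "4 * \<epsilon> / gap + 1 \<le> 3 / 4 * sqrt (real (m * p ^ k) / 2)"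
  shows "\<not> estimates_Z (strongly_convex_smooth 0.5 1.5 d) d \<epsilon> P"
proof -
  interpret prob_space P using P by (simp add: randomized_algorithm_def)
  let ?E = "\<lambda>b A. \<exists>z. outputs d A (pot b) z \<and> accurate \<epsilon> b z"
  have "\<exists>b\<in>Pow cells. measure P {A \<in> space P. ?E b A} \<le> 3 / 4"
  proof (rule exists_unlikely_event)
    fix A assume A: "A \<in> space P"
    have "real (card {b. b \<subseteq> cells \<and> ?E b A}) \<le> 3 / 4 * 2 ^ card cells"
    proof (rule decision_tree_count[where w = m and Q = active and n = n])
      show "x \<in> euclid d" if "A h = Query x" for h x
        using P A that by (auto simp: randomized_algorithm_def)
      show "pot b x = pot b' x \<and> gradient d (pot b) x = gradient d (pot b') x"
        if "b \<subseteq> cells" "b' \<subseteq> cells" "x \<in> euclid d" "b \<inter> active x = b' \<inter> active x" for b b' x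
        using pot_local[OF that(1,2,4)] that by (simp add: gradient_pot)
      show "card (active x \<inter> cells) \<le> m" for x
        using card_active[of x] active_subset[of x] by (simp add: Int_absorb2)
      show "\<exists>z. A (history d A (pot b) n) = Output z" if "b \<subseteq> cells" for b
      proof -
        have "num_queries d A (pot b) \<le> max_queries (strongly_convex_smooth 0.5 1.5 d) d P"
          unfolding max_queries_def using A pot_in_class[OF that] by (meson SUP_upper SUP_upper2)
        then show ?thesis using q num_queries_le_iff order_trans by blast
      qed
    qed (use accurate_count[OF _ _ _ n \<epsilon> scale] in auto)
    moreover have "{b \<in> Pow cells. ?E b A} = {b. b \<subseteq> cells \<and> ?E b A}" by auto
    ultimately show "real (card {b \<in> Pow cells. ?E b A}) \<le> 3 / 4 * real (card (Pow cells))"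
      by (simp only: card_Pow finite_cells) simp
  qed auto
  then obtain b where b: "b \<subseteq> cells" "measure P {A \<in> space P. ?E b A} \<le> 3 / 4" by auto
  then show ?thesis
    using pot_in_class[OF b(1)] unfolding estimates_Z_def accurate_def by (auto simp: not_less intro!: bexI[of _ "pot b"])
qed

section \<open>Explicit size of the gap and the resulting scale condition\<close>

lemma gap_eq: "gap = exp (- (real k / 2)) / (1280 * (2 * real k) ^ k * sqrt (2 * pi) ^ k) / real p ^ (k + 2)"
  using k p by (simp add: gap_def box_mass_def r_def power_add power_divide power_mult_distrib power2_eq_square)

text \<open>Multiplying \<open>small\<close> by \<open>p^k\<close> shows that
  \<open>4 * \<epsilon> / gap\<close> is at most half of \<open>sqrt (m * p^k / 2)\<close>. That
  root is at least 4 because \<open>p^k >= 32\<close>, so the summand 1 takes at most another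
  quarter of it.\<close>

lemma scale_suffices:
  assumes \<eta>: "0 < \<eta>" "gap = \<eta> / real p ^ (k + 2)" and \<epsilon>: "0 < \<epsilon>" and m: "0 < m"
    and big: "32 \<le> real p ^ k" and small: "128 * \<epsilon>\<^sup>2 * real p ^ (k + 4) \<le> \<eta>\<^sup>2 * real m"
  shows "4 * \<epsilon> / gap + 1 \<le> 3 / 4 * sqrt (real (m * p ^ k) / 2)"
proof -
  have p0: "0 < real p" using p by simp
  have "16 \<le> real (m * p ^ k) / 2"
    using big mult_mono[of 1 "real m" 32 "real p ^ k"] m by simp
  then have "sqrt 16 \<le> sqrt (real (m * p ^ k) / 2)" by (rule real_sqrt_le_mono)
  then have "4 \<le> sqrt (real (m * p ^ k) / 2)" by simp
  moreover have "4 * \<epsilon> / gap \<le> 1 / 2 * sqrt (real (m * p ^ k) / 2)"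
  proof (rule power2_le_imp_le)
    have "(128 * \<epsilon>\<^sup>2 * real p ^ (k + 4)) * real p ^ k \<le> (\<eta>\<^sup>2 * real m) * real p ^ k"
      using small by (intro mult_right_mono) auto
    moreover have pp: "real p ^ (k + 4) * real p ^ k = (real p ^ (k + 2))\<^sup>2"
    proof -
      have "k + 4 + k = (k + 2) * 2" by simp
      then show ?thesis by (metis power_add power_mult)
    qed
    ultimately have "128 * \<epsilon>\<^sup>2 * (real p ^ (k + 2))\<^sup>2 \<le> (real m * real p ^ k) * \<eta>\<^sup>2"
      unfolding pp[symmetric] by (simp only: mult_ac)
    then have "128 * \<epsilon>\<^sup>2 * (real p ^ (k + 2))\<^sup>2 / \<eta>\<^sup>2 \<le> real m * real p ^ k"
      using \<eta>(1) by (subst pos_divide_le_eq) simp_all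
    moreover have "(4 * \<epsilon> / gap)\<^sup>2 = 16 * (\<epsilon>\<^sup>2 * (real p ^ (k + 2))\<^sup>2 / \<eta>\<^sup>2)"
      unfolding \<eta>(2) by (simp add: power_divide power_mult_distrib)
    moreover have "(1 / 2 * sqrt (real (m * p ^ k) / 2))\<^sup>2 = real m * real p ^ k / 8"
      by (simp add: power_mult_distrib power_divide)
    ultimately show "(4 * \<epsilon> / gap)\<^sup>2 \<le> (1 / 2 * sqrt (real (m * p ^ k) / 2))\<^sup>2" by simp
  qed simp
  ultimately show ?thesis by linarith
qed

end

subsection \<open>Choice of the scale\<close>

text \<open>The constraint caps \<open>p^(k+4)\<close> at order \<open>d / \<epsilon>^2\<close>, so
  \<open>p^k\<close> reaches the power \<open>\<alpha> = k / (k + 4)\<close> of it. Since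
  \<open>8 / \<gamma> <= k\<close>, the loss \<open>1 - \<alpha>\<close> is at most
  \<open>\<gamma> / 2\<close>.\<close>

lemma choose_scale:
  fixes \<gamma> \<eta> :: real and k :: nat
  assumes \<gamma>: "0 < \<gamma>" and k: "0 < k" "8 / \<gamma> \<le> real k" and \<eta>: "0 < \<eta>"
  obtains c \<epsilon>\<^sub>1 :: real where "0 < c" "0 < \<epsilon>\<^sub>1" "\<epsilon>\<^sub>1 \<le> 1 / 2"
    "\<And>\<epsilon> d. 0 < \<epsilon> \<Longrightarrow> \<epsilon> \<le> \<epsilon>\<^sub>1 \<Longrightarrow> k \<le> d \<Longrightarrow> \<exists>p. 0 < p \<and> 32 \<le> real p ^ k \<and>
      128 * \<epsilon>\<^sup>2 * real p ^ (k + 4) \<le> \<eta>\<^sup>2 * real (d div k) \<and>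
      2 * (c * (real d powr (1 - \<gamma>) * \<epsilon> powr (- (2 - \<gamma>)))) \<le> real p ^ k"
proof -
  define \<alpha> where "\<alpha> = real k / real (k + 4)"
  \<comment> \<open>In \<open>256 * k\<close> a factor \<open>2 * k\<close> pays for
    \<open>d div k\<close> and 128 comes from the constraint; \<open>2^k\<close> pays for rounding
    to an integer \<open>p\<close>, and one more 2 for the demand
    \<open>2 * n <= p^k\<close>.\<close>
  define c where "c = (\<eta>\<^sup>2 / (256 * real k)) powr \<alpha> / 2 ^ (k + 1)"
  \<comment> \<open>Small enough for \<open>Y >= 32^(k+4)\<close>, hence
    \<open>p >= 32\<close>.\<close>
  define \<epsilon>1 where "\<epsilon>1 = min (1 / 2) (\<eta> / (128 * 32 ^ (k + 4)))"
  have \<alpha>: "1 - \<gamma> \<le> \<alpha>" "2 - \<gamma> \<le> 2 * \<alpha>" "0 \<le> \<alpha>"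
  proof -
    have "8 \<le> \<gamma> * real (k + 4)" using k \<gamma> by (simp add: field_simps)
    then have g: "8 / real (k + 4) \<le> \<gamma>" by (simp add: divide_le_eq)
    have a: "\<alpha> = 1 - 4 / real (k + 4)" by (simp add: \<alpha>_def field_simps)
    have "8 / real (k + 4) = 2 * (4 / real (k + 4))" by simp
    then show "2 - \<gamma> \<le> 2 * \<alpha>" using g a by linarith
    then show "1 - \<gamma> \<le> \<alpha>" using \<gamma> by linarith
    show "0 \<le> \<alpha>" by (simp add: \<alpha>_def)
  qed
  have main: "\<exists>p. 0 < p \<and> 32 \<le> real p ^ k \<and>
      128 * \<epsilon>\<^sup>2 * real p ^ (k + 4) \<le> \<eta>\<^sup>2 * real (d div k) \<and>
      2 * (c * (real d powr (1 - \<gamma>) * \<epsilon> powr (- (2 - \<gamma>)))) \<le> real p ^ k"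
    if \<epsilon>: "0 < \<epsilon>" "\<epsilon> \<le> \<epsilon>1" and d: "k \<le> d" for \<epsilon> d
  proof -
    define m where "m = d div k"
    have m1: "1 \<le> m" using d k by (simp add: m_def div_greater_zero_iff Suc_le_eq)
    have md: "real d / (2 * real k) \<le> real m"
    proof -
      have "d = k * m + d mod k" by (simp add: m_def)
      moreover have "d mod k < k" using k by simp
      moreover have "k \<le> k * m" using m1 by simp
      ultimately have "d \<le> 2 * (k * m)" by linarith
      then have "real d \<le> real (2 * (k * m))" by (simp only: of_nat_le_iff)
      then show ?thesis using k by (simp add: field_simps)
    qed
    \<comment> \<open>The largest value that the constraint allows for \<open>p^(k+4)\<close>; its
      real root \<open>X\<close> is rounded down to \<open>p\<close>.\<close>
    define Y where "Y = \<eta>\<^sup>2 * real m / (128 * \<epsilon>\<^sup>2)"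
    have Y: "32 ^ (k + 4) \<le> Y"
    proof -
      have "\<epsilon> \<le> \<eta> / (128 * 32 ^ (k + 4))" using \<epsilon> by (simp add: \<epsilon>1_def)
      then have "\<epsilon>\<^sup>2 \<le> (\<eta> / (128 * 32 ^ (k + 4)))\<^sup>2" using \<epsilon> by (intro power_mono) auto
      also have "\<dots> = \<eta>\<^sup>2 / (128 * 32 ^ (k + 4)) / (128 * 32 ^ (k + 4))"
        by (simp add: power2_eq_square)
      also have "\<dots> \<le> \<eta>\<^sup>2 / (128 * 32 ^ (k + 4)) / 1"
      proof (rule divide_left_mono)
        have "(1::real) \<le> 32 ^ (k + 4)" by (rule one_le_power) simp
        then show "(1::real) \<le> 128 * 32 ^ (k + 4)" by linarith
      qed auto
      finally have "32 ^ (k + 4) \<le> \<eta>\<^sup>2 / (128 * \<epsilon>\<^sup>2)" using \<epsilon> by (simp add: field_simps)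
      also have "\<dots> \<le> \<eta>\<^sup>2 / (128 * \<epsilon>\<^sup>2) * real m"
        using mult_left_mono[of 1 "real m" "\<eta>\<^sup>2 / (128 * \<epsilon>\<^sup>2)"] m1 by simp
      finally show ?thesis by (simp add: Y_def)
    qed
    have Y0: "0 < Y" using Y by (smt (verit) zero_less_power)
    define X where "X = Y powr (1 / real (k + 4))"
    have Xpow: "X ^ (k + 4) = Y"
      using Y0 by (simp add: X_def powr_realpow[symmetric] powr_powr)
    have X32: "32 \<le> X"
    proof (rule power_le_imp_le_base)
      show "32 ^ Suc (k + 3) \<le> X ^ Suc (k + 3)" using Y Xpow by (simp add: eval_nat_numeral)
    qed (simp add: X_def)
    have Xk: "X ^ k = Y powr \<alpha>"
      using Y0 by (simp add: X_def powr_realpow[symmetric] powr_powr \<alpha>_def)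
    define p where "p = nat \<lfloor>X\<rfloor>"
    have p: "real p \<le> X" "X - 1 < real p" using X32 by (auto simp: p_def)
    have p32: "32 \<le> real p" using X32 by (simp add: p_def le_nat_floor)
    have "real p ^ (k + 4) \<le> Y" unfolding Xpow[symmetric] using p by (intro power_mono) auto
    then have A: "128 * \<epsilon>\<^sup>2 * real p ^ (k + 4) \<le> \<eta>\<^sup>2 * real m"
      using \<epsilon> by (simp add: Y_def field_simps)
    have "32 \<le> real p ^ 1" using p32 by simp
    also have "\<dots> \<le> real p ^ k" using p32 k by (intro power_increasing) auto
    finally have B: "32 \<le> real p ^ k" .
    \<comment> \<open>Because \<open>d >= 1\<close> and \<open>\<epsilon> <= 1\<close>, passing to
      the exponents given by \<open>\<alpha>\<close> only increases both factors.\<close>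
    have "real d powr (1 - \<gamma>) * \<epsilon> powr (- (2 - \<gamma>)) \<le> real d powr \<alpha> * \<epsilon> powr (- (2 * \<alpha>))"
    proof (intro mult_mono)
      show "real d powr (1 - \<gamma>) \<le> real d powr \<alpha>" using d k \<alpha> by (intro powr_mono) auto
      show "\<epsilon> powr (- (2 - \<gamma>)) \<le> \<epsilon> powr (- (2 * \<alpha>))"
        using \<epsilon> \<alpha> by (intro powr_mono') (auto simp: \<epsilon>1_def)
    qed auto
    also have "\<dots> = (real d / \<epsilon>\<^sup>2) powr \<alpha>"
    proof -
      have "\<epsilon> powr (- (2 * \<alpha>)) = 1 / (\<epsilon>\<^sup>2) powr \<alpha>"
        using \<epsilon> by (simp add: powr_minus_divide powr_powr[symmetric] powr_numeral)
      then show ?thesis using \<epsilon> by (simp add: powr_divide)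
    qed
    finally have "2 * (c * (real d powr (1 - \<gamma>) * \<epsilon> powr (- (2 - \<gamma>)))) \<le> 2 * (c * (real d / \<epsilon>\<^sup>2) powr \<alpha>)"
      by (intro mult_left_mono) (auto simp: c_def)
    also have "\<dots> = ((\<eta>\<^sup>2 / (256 * real k)) * (real d / \<epsilon>\<^sup>2)) powr \<alpha> / 2 ^ k"
      by (subst powr_mult) (simp_all add: c_def)
    also have "\<dots> \<le> Y powr \<alpha> / 2 ^ k"
    proof (intro divide_right_mono powr_mono2)
      have "(\<eta>\<^sup>2 / (256 * real k)) * (real d / \<epsilon>\<^sup>2) = \<eta>\<^sup>2 / (128 * \<epsilon>\<^sup>2) * (real d / (2 * real k))" by simp
      also have "\<dots> \<le> \<eta>\<^sup>2 / (128 * \<epsilon>\<^sup>2) * real m" using md by (intro mult_left_mono) auto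
      finally show "(\<eta>\<^sup>2 / (256 * real k)) * (real d / \<epsilon>\<^sup>2) \<le> Y" by (simp add: Y_def)
    qed (use \<alpha> in auto)
    also have "\<dots> = (X / 2) ^ k" by (simp add: Xk[symmetric] power_divide)
    \<comment> \<open>Rounding down loses at most a factor 2:
      \<open>X / 2 <= X - 1 < p\<close>.\<close>
    also have "\<dots> \<le> real p ^ k" using p X32 by (intro power_mono) auto
    finally have "2 * (c * (real d powr (1 - \<gamma>) * \<epsilon> powr (- (2 - \<gamma>)))) \<le> real p ^ k" .
    with A B p32 show ?thesis unfolding m_def by (intro exI[of _ p]) auto
  qed
  show ?thesis
    by (rule that[of c \<epsilon>1]) (use main \<eta> k in \<open>auto simp: c_def \<epsilon>1_def\<close>)
qed

section \<open>From the limit condition to explicit parameters\<close>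

theorem theorem1p3:
  fixes \<gamma> :: real
  assumes "\<gamma> > 0"
  shows "\<exists>d\<^sub>0::nat. \<forall>P :: nat \<Rightarrow> real \<Rightarrow> strategy measure.
    (\<forall>d\<ge>d\<^sub>0. \<forall>\<epsilon>>0. randomized_algorithm d (P d \<epsilon>)) \<longrightarrow>
    ((\<lambda>\<epsilon>. SUP d\<in>{d\<^sub>0..}.
        ereal_of_enat (max_queries (strongly_convex_smooth 0.5 1.5 d) d (P d \<epsilon>)) /
        ereal (real d powr (1 - \<gamma>) * \<epsilon> powr (- (2 - \<gamma>)))) \<longlongrightarrow> 0) (at_right 0) \<longrightarrow>
    (\<exists>\<epsilon>\<^sub>0>0. \<forall>\<epsilon>>0. \<epsilon> \<le> \<epsilon>\<^sub>0 \<longrightarrow>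
      (\<forall>d\<ge>d\<^sub>0. \<not> estimates_Z (strongly_convex_smooth 0.5 1.5 d) d \<epsilon> (P d \<epsilon>)))"
proof -
  define k where "k = max 1 (nat \<lceil>8 / \<gamma>\<rceil>)"
  have k: "0 < k" "8 / \<gamma> \<le> real k" by (auto simp: k_def le_max_iff_disj) linarith
  define \<eta> where "\<eta> = exp (- (real k / 2)) / (1280 * (2 * real k) ^ k * sqrt (2 * pi) ^ k)"
  have \<eta>: "0 < \<eta>" using k by (simp add: \<eta>_def)
  obtain c \<epsilon>\<^sub>1 :: real where c: "0 < c" and \<epsilon>\<^sub>1: "0 < \<epsilon>\<^sub>1" "\<epsilon>\<^sub>1 \<le> 1 / 2" and scale:
    "\<And>\<epsilon> d. 0 < \<epsilon> \<Longrightarrow> \<epsilon> \<le> \<epsilon>\<^sub>1 \<Longrightarrow> k \<le> d \<Longrightarrow> \<exists>p. 0 < p \<and> 32 \<le> real p ^ k \<and>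
      128 * \<epsilon>\<^sup>2 * real p ^ (k + 4) \<le> \<eta>\<^sup>2 * real (d div k) \<and>
      2 * (c * (real d powr (1 - \<gamma>) * \<epsilon> powr (- (2 - \<gamma>)))) \<le> real p ^ k"
    using choose_scale[OF assms k \<eta>] by blast
  show ?thesis
  \<comment> \<open>The threshold dimension is the block length itself, which guarantees at least
    one block.\<close>
  proof (intro exI[of _ k] allI impI)
    fix P :: "nat \<Rightarrow> real \<Rightarrow> strategy measure"
    assume P: "\<forall>d\<ge>k. \<forall>\<epsilon>>0. randomized_algorithm d (P d \<epsilon>)"
    let ?q = "\<lambda>d \<epsilon>. max_queries (strongly_convex_smooth 0.5 1.5 d) d (P d \<epsilon>)"
    let ?w = "\<lambda>d \<epsilon>. real d powr (1 - \<gamma>) * \<epsilon> powr (- (2 - \<gamma>))"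
    assume "((\<lambda>\<epsilon>. SUP d\<in>{k..}. ereal_of_enat (?q d \<epsilon>) / ereal (?w d \<epsilon>)) \<longlongrightarrow> 0) (at_right 0)"
    \<comment> \<open>The limit enters only through the supremum being eventually below the fixed
      constant \<open>c\<close>, uniformly in the dimension.\<close>
    then have "\<forall>\<^sub>F \<epsilon> in at_right 0. (SUP d\<in>{k..}. ereal_of_enat (?q d \<epsilon>) / ereal (?w d \<epsilon>)) < ereal c"
      using c by (intro order_tendstoD(2)) auto
    then obtain \<epsilon>\<^sub>2 where \<epsilon>\<^sub>2: "0 < \<epsilon>\<^sub>2"
      "\<And>\<epsilon>. 0 < \<epsilon> \<Longrightarrow> \<epsilon> < \<epsilon>\<^sub>2 \<Longrightarrow> (SUP d\<in>{k..}. ereal_of_enat (?q d \<epsilon>) / ereal (?w d \<epsilon>)) < ereal c"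
      unfolding eventually_at_right_field by auto
    have "\<not> estimates_Z (strongly_convex_smooth 0.5 1.5 d) d \<epsilon> (P d \<epsilon>)"
      if \<epsilon>: "0 < \<epsilon>" "\<epsilon> \<le> min \<epsilon>\<^sub>1 (\<epsilon>\<^sub>2 / 2)" and d: "k \<le> d" for \<epsilon> d
    proof -
      have w: "0 < ?w d \<epsilon>" using \<epsilon> d k by simp
      have "ereal_of_enat (?q d \<epsilon>) / ereal (?w d \<epsilon>) \<le> (SUP d\<in>{k..}. ereal_of_enat (?q d \<epsilon>) / ereal (?w d \<epsilon>))"
        using d by (intro SUP_upper) simp
      also have "\<dots> < ereal c" using \<epsilon> \<epsilon>\<^sub>2 by (intro \<epsilon>\<^sub>2(2)) auto
      finally have lt: "ereal_of_enat (?q d \<epsilon>) / ereal (?w d \<epsilon>) < ereal c" .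
      \<comment> \<open>A ratio below a real number rules out the value infinity, so the number of
        queries is a natural number.\<close>
      then obtain n where n: "?q d \<epsilon> = enat n" using w by (cases "?q d \<epsilon>") auto
      have "real n / W < c" if "ereal_of_enat (enat n) / ereal W < ereal c" "0 < W" for W
        using that by simp
      then have "real n / ?w d \<epsilon> < c" using lt w unfolding n .
      then have n_lt: "real n < c * ?w d \<epsilon>" using w by (simp add: divide_less_eq)
      obtain p where p_props: "0 < p" "32 \<le> real p ^ k" "128 * \<epsilon>\<^sup>2 * real p ^ (k + 4) \<le> \<eta>\<^sup>2 * real (d div k)"
        "2 * (c * ?w d \<epsilon>) \<le> real p ^ k"
        using scale[of \<epsilon> d] \<epsilon> d by auto
      interpret bump_grid k "d div k" p d
        by standard (use k p_props in auto)
      have "real (2 * n) \<le> real (p ^ k)" using n_lt p_props(4) by simp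
      then have "2 * n \<le> p ^ k" by (simp only: of_nat_le_iff)
      moreover have "0 < d div k" using d k by (simp add: div_greater_zero_iff)
      then have "4 * \<epsilon> / gap + 1 \<le> 3 / 4 * sqrt (real (d div k * p ^ k) / 2)"
        using scale_suffices[OF \<eta> _ \<epsilon>(1) _ p_props(2,3)] gap_eq by (simp add: \<eta>_def)
      ultimately show ?thesis
        using P \<epsilon> \<epsilon>\<^sub>1 d n by (intro not_estimates_Z[of _ n]) auto
    qed
    then show "\<exists>\<epsilon>\<^sub>0>0. \<forall>\<epsilon>>0. \<epsilon> \<le> \<epsilon>\<^sub>0 \<longrightarrow>
      (\<forall>d\<ge>k. \<not> estimates_Z (strongly_convex_smooth 0.5 1.5 d) d \<epsilon> (P d \<epsilon>))"
      using \<epsilon>\<^sub>1 \<epsilon>\<^sub>2 by (intro exI[of _ "min \<epsilon>\<^sub>1 (\<epsilon>\<^sub>2 / 2)"]) auto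
  qed
qed

end
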